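(* Let $a$ be a non-negative integer, let $b$ be an odd positive integer, let $n:=2^ab$ with $n\geq 3$, and let $k$ be a positive integer with $k\leq n-1$. Then the Praeger-Xu graph $\mathrm{PX}(n,k)$ is a Cayley graph if, and only if, $k$ can be written as $$k=\sum_{d\mid b}\alpha_d\,\omega(d)$$ for some integers $\alpha_d$ (one for each positive divisor $d$ of $b$) with $$0\leq \alpha_d\leq \frac{2^a\varphi(d)}{\omega(d)}.$$
   Context: For integers $n\geq 3$ and $1\leq k\leq n-1$, the Praeger-Xu graph $\mathrm{PX}(n,k)$ is the finite simple undirected graph with vertex set $\mathbb{Z}_n\times \mathbb{Z}_2^k$ (so it has $n2^k$ vertices), in which, for every $i\in\mathbb{Z}_n$ and all $x_0,x_1,\ldots,x_{k}\in\mathbb{Z}_2$, the vertex $(i,(x_0,x_1,\ldots,x_{k-1}))$ is adjacent to the vertex $(i+1,(x_1,\ldots,x_{k-1},x_k))$, and there are no other adjacencies. (For $k=1$ this means that $(i,x)$ is adjacent to $(i+1,y)$ for all $i\in\mathbb{Z}_n$ and $x,y\in\mathbb{Z}_2$.) A graph is a Cayley graph if it is isomorphic to $\mathrm{Cay}(G,S)$ for some group $G$ and some subset $S\subseteq G\setminus\{1\}$ with $S=S^{-1}$, where $\mathrm{Cay}(G,S)$ has vertex set $G$ and $g$ is adjacent to $h$ exactly when $hg^{-1}\in S$; equivalently, its automorphism group contains a subgroup acting regularly on the vertices. $\varphi$ denotes the Euler $\varphi$-function. For an odd positive integer $d$, $\omega(d):=\min\{c\in\mathbb{N}\mid c\geq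 1,\ d\text{ divides }2^c-1\}$ is the multiplicative order of $2$ modulo $d$; in particular $\omega(1)=1$. *)

theory Defs
  imports
    "HOL-Library.Z2"
    "HOL-Number_Theory.Number_Theory"
    "Graph_Theory.Graph_Theory"
begin

text \<open>
  A simple undirected graph is represented by a digraph whose arc set is a symmetric and irreflexive
  set of ordered pairs (see \<^locale>\<open>pair_graph\<close>).  For such graphs \<^const>\<open>digraph_iso\<close> is the usual
  notion of graph isomorphism, as \<open>digraph_iso_with_proj_iff\<close> below shows.
\<close>

definition Cay :: "('g, 'm) monoid_scheme \<Rightarrow> 'g set \<Rightarrow> 'g pair_pre_digraph" where
  "Cay G S = \<lparr> pverts = carrier G,
     parcs = {(g, h). g \<in> carrier G \<and> h \<in> carrier G \<and> h \<otimes>\<^bsub>G\<^esub> inv\<^bsub>G\<^esub> g \<in> S} \<rparr>"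

text \<open>
  HOL does not allow quantifying over the type of the group elements, so the group is taken over the
  vertex type.  This is no restriction, by \<open>cayley_graphI\<close> below.
\<close>

definition cayley_graph :: "'v pair_pre_digraph \<Rightarrow> bool" where
  "cayley_graph \<Gamma> \<longleftrightarrow> (\<exists>(G :: 'v monoid) S. group G \<and> S \<subseteq> carrier G - {\<one>\<^bsub>G\<^esub>} \<and>
     S = m_inv G ` S \<and> digraph_iso (with_proj (Cay G S)) (with_proj \<Gamma>))"

text \<open>
  \<open>\<int>\<^sub>n\<close> is represented by \<open>{..<n}\<close> with addition modulo \<open>n\<close>, and \<open>\<int>\<^sub>2\<^sup>k\<close> by lists of length \<open>k\<close>
  over the two-element field \<^typ>\<open>bit\<close>.
\<close>

definition PX_step :: "nat \<Rightarrow> nat \<Rightarrow> (nat \<times> bit list) rel" where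
  "PX_step n k =
     {((i, map x [0..<k]), ((i + 1) mod n, map x [1..<k + 1])) | i (x :: nat \<Rightarrow> bit). i < n}"

definition PX :: "nat \<Rightarrow> nat \<Rightarrow> (nat \<times> bit list) pair_pre_digraph" where
  "PX n k = \<lparr> pverts = {..<n} \<times> {xs. length xs = k}, parcs = PX_step n k \<union> (PX_step n k)\<inverse> \<rparr>"

definition omega :: "nat \<Rightarrow> nat" where
  "omega d = (LEAST c. c \<ge> 1 \<and> d dvd 2 ^ c - 1)"


lemma omega_eq_ord:
  assumes "odd d"
  shows "omega d = ord d 2"
proof -
  have "d dvd 2 ^ c - 1 \<longleftrightarrow> [2 ^ c = 1] (mod d)" for c :: nat
    using cong_altdef_nat[of 1 "2 ^ c" d] by (simp add: cong_sym_eq)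
  with assms show ?thesis
    by (simp add: omega_def ord_def Suc_le_eq)
qed

lemma digraph_iso_with_proj_iff:
  assumes "pair_wf_digraph \<Gamma>"
  shows "digraph_iso (with_proj \<Gamma>) (with_proj \<Delta>) \<longleftrightarrow>
    (\<exists>f. bij_betw f (pverts \<Gamma>) (pverts \<Delta>) \<and> parcs \<Delta> = map_prod f f ` parcs \<Gamma>)" (is "?L \<longleftrightarrow> ?R")
proof
  assume ?L
  then obtain F where F: "pre_digraph.digraph_isomorphism (with_proj \<Gamma>) F"
    and eq: "with_proj \<Delta> = app_iso F (with_proj \<Gamma>)"
    by (auto simp: digraph_iso_def)
  from eq have *: "pverts \<Delta> = iso_verts F ` pverts \<Gamma>" "parcs \<Delta> = iso_arcs F ` parcs \<Gamma>"
    "iso_tail F = fst" "iso_head F = snd"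
    by (simp_all add: with_proj_def app_iso_def)
  have "iso_arcs F e = map_prod (iso_verts F) (iso_verts F) e" if "e \<in> parcs \<Gamma>" for e
    using F that * by (auto simp: pre_digraph.digraph_isomorphism_def prod_eq_iff)
  then have "parcs \<Delta> = map_prod (iso_verts F) (iso_verts F) ` parcs \<Gamma>"
    by (simp add: *)
  with * F show ?R
    by (auto simp: pre_digraph.digraph_isomorphism_def bij_betw_def intro!: exI[of _ "iso_verts F"])
next
  assume ?R
  then obtain f where f: "bij_betw f (pverts \<Gamma>) (pverts \<Delta>)" "parcs \<Delta> = map_prod f f ` parcs \<Gamma>"
    by blast
  interpret pair_wf_digraph \<Gamma> by fact
  define F :: "('a, 'a \<times> 'a, 'b, 'b \<times> 'b) digraph_isomorphism" where
    "F = \<lparr> iso_verts = f, iso_arcs = map_prod f f, iso_head = snd, iso_tail = fst \<rparr>"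
  have "inj_on (map_prod f f) (parcs \<Gamma>)"
    using map_prod_inj_on[OF bij_betw_imp_inj_on[OF f(1)] bij_betw_imp_inj_on[OF f(1)]]
    by (rule inj_on_subset) (auto dest: in_arcsD1 in_arcsD2)
  then have "pre_digraph.digraph_isomorphism (with_proj \<Gamma>) F"
    using f(1) wf_digraph_axioms
    by (auto simp: pre_digraph.digraph_isomorphism_def F_def bij_betw_def)
  moreover have "with_proj \<Delta> = app_iso F (with_proj \<Gamma>)"
    using f by (simp add: with_proj_def app_iso_def F_def bij_betw_def)
  ultimately show ?L by (auto simp: digraph_iso_def)
qed

lemma pverts_Cay: "pverts (Cay G S) = carrier G"
  by (simp add: Cay_def)

lemma pair_wf_digraph_Cay: "pair_wf_digraph (Cay G S)"
  by unfold_locales (auto simp: Cay_def)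

lemma cayley_graphI:
  fixes G :: "('g, 'm) monoid_scheme" and \<Gamma> :: "'v pair_pre_digraph"
  assumes "group G" and S: "S \<subseteq> carrier G - {\<one>\<^bsub>G\<^esub>}" "S = m_inv G ` S"
    and iso: "digraph_iso (with_proj (Cay G S)) (with_proj \<Gamma>)"
  shows "cayley_graph \<Gamma>"
proof -
  interpret G: group G by fact
  obtain f where bij: "bij_betw f (carrier G) (pverts \<Gamma>)"
    and arcs: "parcs \<Gamma> = map_prod f f ` parcs (Cay G S)"
    using iso[unfolded digraph_iso_with_proj_iff[OF pair_wf_digraph_Cay]]
    unfolding pverts_Cay by blast
  define g where "g = the_inv_into (carrier G) f"
  have inj: "inj_on f (carrier G)" and img: "f ` carrier G = pverts \<Gamma>"
    using bij by (auto simp: bij_betw_def)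
  have gf: "g (f x) = x" if "x \<in> carrier G" for x
    using that inj by (simp add: g_def the_inv_into_f_f)
  define K :: "'v monoid" where
    "K = \<lparr> carrier = UNIV, mult = (\<lambda>x y. f (g x \<otimes>\<^bsub>G\<^esub> g y)), one = undefined \<rparr>"
  define H :: "'v monoid" where
    "H = K\<lparr> carrier := f ` carrier G, one := f \<one>\<^bsub>G\<^esub> \<rparr>"
  have "f \<in> hom G K"
    by (auto simp: hom_def K_def gf)
  then have "group H"
    unfolding H_def by (rule G.hom_imp_img_group)
  interpret H: group H by fact
  have carr: "carrier H = f ` carrier G" and one: "\<one>\<^bsub>H\<^esub> = f \<one>\<^bsub>G\<^esub>"
    by (simp_all add: H_def)
  have mult: "f x \<otimes>\<^bsub>H\<^esub> f y = f (x \<otimes>\<^bsub>G\<^esub> y)" if "x \<in> carrier G" "y \<in> carrier G" for x y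
    using that by (simp add: H_def K_def gf)
  have inv: "inv\<^bsub>H\<^esub> (f x) = f (inv\<^bsub>G\<^esub> x)" if "x \<in> carrier G" for x
    by (rule H.inv_equality) (use that in \<open>auto simp: mult one carr\<close>)
  have sub: "S \<subseteq> carrier G" using S by auto
  have "m_inv H ` f ` S = f ` m_inv G ` S"
    unfolding image_image by (rule image_cong) (use sub in \<open>auto simp: inv\<close>)
  with S(2) have S': "f ` S = m_inv H ` f ` S" by simp
  have "f ` S \<subseteq> carrier H - {\<one>\<^bsub>H\<^esub>}"
    using S(1) inj by (auto simp: carr one inj_on_def)
  moreover have "Cay H (f ` S) = \<Gamma>"
  proof -
    have *: "f y \<otimes>\<^bsub>H\<^esub> inv\<^bsub>H\<^esub> f x \<in> f ` S \<longleftrightarrow> y \<otimes>\<^bsub>G\<^esub> inv\<^bsub>G\<^esub> x \<in> S"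
      if "x \<in> carrier G" "y \<in> carrier G" for x y
      using that sub inj by (simp add: inv mult inj_on_image_mem_iff)
    have "parcs (Cay H (f ` S)) = map_prod f f ` parcs (Cay G S)"
    proof (rule Set.set_eqI)
      fix e
      show "e \<in> parcs (Cay H (f ` S)) \<longleftrightarrow> e \<in> map_prod f f ` parcs (Cay G S)"
      proof
        assume "e \<in> parcs (Cay H (f ` S))"
        then obtain x y where "x \<in> carrier G" "y \<in> carrier G" "e = (f x, f y)"
          "f y \<otimes>\<^bsub>H\<^esub> inv\<^bsub>H\<^esub> f x \<in> f ` S"
          unfolding Cay_def carr by auto
        with * have "(x, y) \<in> parcs (Cay G S)" "e = map_prod f f (x, y)"
          by (simp_all add: Cay_def)
        then show "e \<in> map_prod f f ` parcs (Cay G S)"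
          by (rule rev_image_eqI)
      qed (auto simp: Cay_def carr *)
    qed
    then show ?thesis
      using arcs img by (simp add: Cay_def carr)
  qed
  then have "digraph_iso (with_proj (Cay H (f ` S))) (with_proj \<Gamma>)"
    unfolding digraph_iso_with_proj_iff[OF pair_wf_digraph_Cay]
    by (intro exI[of _ id]) (simp add: prod.map_id0)
  ultimately show ?thesis
    unfolding cayley_graph_def using \<open>group H\<close> S' by blast
qed

lemma pair_graph_PX:
  assumes "n \<ge> 3"
  shows "pair_graph (PX n k)"
proof
  fix e assume "e \<in> parcs (PX n k)"
  then show "fst e \<in> pverts (PX n k)" "snd e \<in> pverts (PX n k)"
    using assms by (auto simp: PX_def PX_step_def)
next
  fix e assume "e \<in> parcs (PX n k)"
  moreover have "(i + 1) mod n \<noteq> i" if "i < n" for i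
    using that assms by (cases "i + 1 = n") auto
  ultimately show "fst e \<noteq> snd e"
    by (fastforce simp: PX_def PX_step_def)
next
  have fin: "finite {xs :: bit list. length xs = k}"
  proof -
    have "(UNIV :: bit set) \<subseteq> {0, 1}"
      by (metis bit_not_zero_iff insertCI subsetI)
    then have "finite (UNIV :: bit set)"
      by (rule finite_subset) simp
    from finite_lists_length_eq[OF this, of k] show ?thesis by simp
  qed
  then show "finite (pverts (PX n k))"
    by (simp add: PX_def)
  have "parcs (PX n k) \<subseteq> pverts (PX n k) \<times> pverts (PX n k)"
    using assms by (auto simp: PX_def PX_step_def)
  then show "finite (parcs (PX n k))"
    using fin by (rule_tac finite_subset) (auto simp: PX_def)
next
  show "symmetric (with_proj (PX n k))"
    by (auto simp: symmetric_def PX_def sym_def)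
qed

end

theory Submission
  imports Defs "HOL-Library.Function_Algebras" "HOL-Algebra.Algebraic_Closure_Type"
begin

text \<open>
  The graph \<open>PX(n,k)\<close> is Cayley iff \<open>t^n - 1\<close> has a divisor of degree \<open>k\<close> over the field with two
  elements.  Given such a divisor \<open>f\<close>, the \<open>n\<close>-periodic sequences satisfying the linear recurrence
  \<open>f\<close> form a space of dimension \<open>k\<close>, and its extension by the cyclic shift acts regularly.

  Conversely, let \<open>k \<ge> 2\<close> and \<open>n \<noteq> 4\<close> (otherwise a suitable power of \<open>t - 1\<close> is a divisor).  Two
  neighbours of a vertex have a second common neighbour iff they lie on the same side of it, so every
  automorphism preserves or reverses the orientation; the orientation-preserving ones are a rotation
  composed with a flip, the addition of an \<open>n\<close>-periodic sequence.  The flips in a regular group form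
  a code \<open>C\<close> invariant under a shift by 2.  If no element reverses the orientation and fixes fibre 0,
  then \<open>|C| = 2^k\<close>.  Otherwise \<open>|C| = 2^(k-1)\<close>, \<open>C\<close> is cyclic and all of its words have even
  weight, whence the preimage of \<open>C\<close> under \<open>1 + shift\<close> is a cyclic code of size \<open>2^k\<close>.  In both
  cases the code has dimension equal to the degree of a divisor of \<open>t^n - 1\<close>.

  The degrees of such divisors are read off from the irreducible factors \<open>q\<close> of \<open>t^b - 1\<close>: if \<open>t\<close> has
  order \<open>d\<close> modulo \<open>q\<close>, then \<open>q\<close> has degree \<open>\<omega>(d)\<close>, and the degrees of all such \<open>q\<close> sum to \<open>\<phi>(d)\<close>.
\<close>

section \<open>The field with two elements as a coefficient field\<close>

hide_const (open) Divisibility.prime Polynomials.degree Polynomials.lead_coeff up_ring.monom up_ring.coeff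

text \<open>Sums, products and powers of bits stay field operations instead of being rewritten to
  logical ones.\<close>

declare add_bit_eq_xor [simp del] mult_bit_eq_and [simp del] power_bit_unfold [simp del]

text \<open>This structure on the coefficients gives \<open>bit poly\<close> its gcd and unique
  factorisation. As 1 is the only nonzero bit, normalising and taking the unit factor are both the
  identity.\<close>

instantiation bit ::
  "{unique_euclidean_ring, normalization_euclidean_semiring, normalization_semidom_multiplicative}"
begin

definition [simp]: "normalize_bit = (id :: bit \<Rightarrow> bit)"
definition [simp]: "unit_factor_bit = (id :: bit \<Rightarrow> bit)"
definition [simp]: "euclidean_size_bit x = (if x = (0::bit) then 0 else 1 :: nat)"
definition [simp]: "division_segment (x :: bit) = 1"

instance
proof
  show "is_unit (unit_factor a)" if "a \<noteq> 0" for a :: bit using that by simp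
qed (auto simp add: dvd_field_iff split: if_splits simp del: minus_bit_def divide_bit_def uminus_bit_def inverse_bit_def)

end

instantiation bit :: euclidean_ring_gcd
begin

definition gcd_bit :: "bit \<Rightarrow> bit \<Rightarrow> bit" where
  "gcd_bit = Euclidean_Algorithm.gcd"
definition lcm_bit :: "bit \<Rightarrow> bit \<Rightarrow> bit" where
  "lcm_bit = Euclidean_Algorithm.lcm"
definition Gcd_bit :: "bit set \<Rightarrow> bit" where
 "Gcd_bit = Euclidean_Algorithm.Gcd"
definition Lcm_bit :: "bit set \<Rightarrow> bit" where
 "Lcm_bit = Euclidean_Algorithm.Lcm"

instance by standard (simp_all add: gcd_bit_def lcm_bit_def Gcd_bit_def Lcm_bit_def)

end

instance bit :: field_gcd ..

section \<open>Factors of \<open>t^n - 1\<close>\<close>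

lemma bit_add_self [simp]: "x + x = (0 :: bit)"
  by (cases x) simp_all

lemma bit_poly_add_self [simp]: "p + p = (0 :: bit poly)"
  by (rule poly_eqI) (simp only: coeff_add bit_add_self coeff_0)

lemma bit_poly_add_self_left [simp]: "p + (p + q) = (q :: bit poly)"
  by (simp flip: add.assoc)

lemma card_UNIV_bit: "card (UNIV :: bit set) = 2" and finite_UNIV_bit [simp]: "finite (UNIV :: bit set)"
proof -
  have *: "(UNIV :: bit set) = {0, 1}"
    by (metis (full_types) UNIV_eq_I bit_not_zero_iff insertCI)
  show "card (UNIV :: bit set) = 2" "finite (UNIV :: bit set)"
    unfolding * by simp_all
qed

text \<open>Iterated Frobenius map: in each squaring the mixed term occurs twice and
  cancels.\<close>

lemma bit_poly_power2_add: "(p + q) ^ 2 ^ a = p ^ 2 ^ a + (q :: bit poly) ^ 2 ^ a"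
proof (induction a)
  case (Suc a)
  have sq: "(x + y) * (x + y) = x * x + y * y" for x y :: "bit poly"
    by (simp add: algebra_simps)
  show ?case
    by (simp only: power_Suc mult.commute[of 2] power_mult Suc power2_eq_square sq)
qed simp

text \<open>A nonzero polynomial over this field is monic, so factorisations hold without a unit
  factor.\<close>

lemma normalize_bit_poly [simp]: "normalize (p :: bit poly) = p"
proof (cases "p = 0")
  case False
  then have "lead_coeff p = 1" by (metis bit_not_one_iff leading_coeff_0_iff)
  then show ?thesis by (simp add: normalize_poly_eq_map_poly map_poly_idI)
qed simp

text \<open>In characteristic 2 this is \<open>t^n - 1\<close>.\<close>

definition cyc :: "nat \<Rightarrow> bit poly" where
  "cyc n = monom 1 n + 1"

lemma cyc_0 [simp]: "cyc 0 = 0"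
  by (simp add: cyc_def one_pCons monom_0)

lemma degree_cyc [simp]: "degree (cyc n) = n"
proof (cases "n = 0")
  case False
  then show ?thesis
    unfolding cyc_def by (subst degree_add_eq_left) (simp_all add: degree_monom_eq)
qed simp

lemma cyc_eq_0_iff [simp]: "cyc n = 0 \<longleftrightarrow> n = 0"
  by (metis cyc_0 degree_0 degree_cyc)

text \<open>Frobenius reduces n = 2^a b to its odd part: t^n - 1 is the 2^a-th power of t^b -
  1.\<close>

lemma cyc_power2: "cyc n ^ 2 ^ a = cyc (2 ^ a * n)"
  by (simp add: cyc_def bit_poly_power2_add monom_power mult.commute)

lemma cyc_add: "cyc (i + j) = monom 1 j * cyc i + cyc j"
  by (simp add: cyc_def algebra_simps mult_monom flip: add.assoc)

lemma cyc_dvd_cyc_mult: "cyc d dvd cyc (d * m)"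
  by (induction m) (simp_all add: cyc_add)

section \<open>Irreducible factors sorted by the order of the variable\<close>

definition cyc_primes :: "nat \<Rightarrow> bit poly set" where
  "cyc_primes d = {q. prime q \<and> q dvd cyc d \<and> (\<forall>e. 0 < e \<and> e < d \<longrightarrow> \<not> q dvd cyc e)}"

text \<open>The order of the variable modulo \<open>q\<close> is \<open>d\<close>:
  \<open>cyc_add\<close> reduces \<open>j\<close> modulo \<open>d\<close>, and the minimality of
  \<open>d\<close> excludes a nonzero remainder.\<close>

lemma cyc_primes_dvd_cyc_iff:
  assumes "q \<in> cyc_primes d" "d > 0"
  shows "q dvd cyc j \<longleftrightarrow> d dvd j"
proof -
  have "q dvd cyc d" using assms by (simp add: cyc_primes_def)
  then have "q dvd cyc (d * (j div d))"
    using cyc_dvd_cyc_mult dvd_trans by blast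
  then have "q dvd monom 1 (j mod d) * cyc (d * (j div d))" by simp
  then have "q dvd cyc j \<longleftrightarrow> q dvd cyc (j mod d)"
    using cyc_add[of "d * (j div d)" "j mod d"] by (simp add: dvd_add_right_iff)
  also have "\<dots> \<longleftrightarrow> j mod d = 0"
    using assms by (auto simp: cyc_primes_def intro: Nat.gr0I)
  finally show ?thesis by (simp add: dvd_eq_mod_eq_0)
qed

lemma prime_factors_cyc:
  assumes "n > 0"
  shows "prime_factors (cyc n) = (\<Union>d\<in>{d. d dvd n}. cyc_primes d)"
proof (intro subset_antisym subsetI)
  fix q assume "q \<in> prime_factors (cyc n)"
  then have q: "prime q" "q dvd cyc n" by auto
  define d where "d = (LEAST e. 0 < e \<and> q dvd cyc e)"
  have d: "0 < d" "q dvd cyc d"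
    using LeastI[of "\<lambda>e. 0 < e \<and> q dvd cyc e" n] q assms by (auto simp: d_def)
  moreover have "\<not> q dvd cyc e" if "0 < e" "e < d" for e
    using not_less_Least[of e "\<lambda>e. 0 < e \<and> q dvd cyc e"] that by (auto simp: d_def)
  ultimately have *: "q \<in> cyc_primes d" using q by (auto simp: cyc_primes_def)
  with cyc_primes_dvd_cyc_iff[OF * \<open>0 < d\<close>] q show "q \<in> (\<Union>d\<in>{d. d dvd n}. cyc_primes d)"
    by auto
next
  fix q assume "q \<in> (\<Union>d\<in>{d. d dvd n}. cyc_primes d)"
  then obtain d where d: "d dvd n" "q \<in> cyc_primes d" by auto
  then have "q dvd cyc n"
    using cyc_primes_dvd_cyc_iff[of q d n] assms by (auto intro: Nat.gr0I)
  with d assms show "q \<in> prime_factors (cyc n)"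
    by (auto simp: cyc_primes_def in_prime_factors_iff)
qed

lemma finite_cyc_primes: "d > 0 \<Longrightarrow> finite (cyc_primes d)"
  by (rule finite_subset[of _ "prime_factors (cyc d)"]) (auto simp: cyc_primes_def in_prime_factors_iff)

lemma cyc_primes_disjoint:
  assumes "d > 0" "e > 0" "d \<noteq> e"
  shows "cyc_primes d \<inter> cyc_primes e = {}"
  using assms cyc_primes_dvd_cyc_iff by (metis dvd_antisym dvd_refl disjoint_iff)

section \<open>Degrees of the irreducible factors\<close>

definition polys_below :: "nat \<Rightarrow> bit poly set" where
  \<comment> \<open>A condition on coefficients instead of the degree gives the zero space at
    \<open>m = 0\<close>, where \<open>degree 0 = 0\<close> would get in the way.\<close>
  "polys_below m = {p. \<forall>i\<ge>m. coeff p i = 0}"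

lemma polys_below_iff: "m > 0 \<Longrightarrow> p \<in> polys_below m \<longleftrightarrow> degree p < m"
  unfolding polys_below_def using le_degree[of p]
  by (auto intro: coeff_eq_0) (metis degree_0 leading_coeff_0_iff leI)

lemma polys_below_Suc: "polys_below (Suc m) = (\<lambda>(a, p). pCons a p) ` (UNIV \<times> polys_below m)"
proof (intro subset_antisym subsetI)
  fix p assume "p \<in> polys_below (Suc m)"
  then show "p \<in> (\<lambda>(a, p). pCons a p) ` (UNIV \<times> polys_below m)"
    by (cases p) (auto simp: polys_below_def coeff_pCons split: nat.splits)
qed (auto simp: polys_below_def coeff_pCons split: nat.splits)

lemma card_polys_below: "card (polys_below m) = 2 ^ m" and finite_polys_below: "finite (polys_below m)"
proof (induction m)
  case 0
  have "polys_below 0 = {0}" by (auto simp: polys_below_def intro: poly_eqI)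
  then show "card (polys_below 0) = 2 ^ 0" "finite (polys_below 0)" by simp_all
next
  case (Suc m)
  have "inj_on (\<lambda>(a, p). pCons a p) (UNIV \<times> polys_below m)" by (auto simp: inj_on_def)
  with Suc show "card (polys_below (Suc m)) = 2 ^ Suc m" "finite (polys_below (Suc m))"
    by (simp_all add: polys_below_Suc card_image card_UNIV_bit)
qed

definition eval_ac :: "bit alg_closure \<Rightarrow> bit poly \<Rightarrow> bit alg_closure" where
  "eval_ac z p = poly (map_poly to_ac p) z"

lemma eval_ac_0 [simp]: "eval_ac z 0 = 0"
  and eval_ac_pCons [simp]: "eval_ac z (pCons a p) = to_ac a + z * eval_ac z p"
  by (simp_all add: eval_ac_def map_poly_pCons)

lemma eval_ac_1 [simp]: "eval_ac z 1 = 1"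
  by (simp add: one_pCons)

lemma eval_ac_add: "eval_ac z (p + q) = eval_ac z p + eval_ac z q"
  by (induction p q rule: poly_induct2) (simp_all add: algebra_simps)

lemma eval_ac_smult: "eval_ac z (smult a p) = to_ac a * eval_ac z p"
  by (induction p) (simp_all add: algebra_simps)

lemma eval_ac_mult: "eval_ac z (p * q) = eval_ac z p * eval_ac z q"
  by (induction p) (simp_all add: eval_ac_add eval_ac_smult algebra_simps)

lemma eval_ac_monom: "eval_ac z (monom 1 n) = z ^ n"
  by (induction n) (simp_all add: monom_0 monom_Suc)

lemma ac_add_self [simp]: "x + x = (0 :: bit alg_closure)"
proof -
  have "(1 :: bit alg_closure) + 1 = to_ac (1 + 1)" by (simp only: to_ac_add to_ac_1)
  then have "(1 :: bit alg_closure) + 1 = 0" by simp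
  then have "x * (1 + 1) = 0" by (simp only: mult_zero_right)
  then show ?thesis by (simp add: algebra_simps)
qed

lemma ac_power2_add: "(x + y) ^ 2 ^ a = x ^ 2 ^ a + (y :: bit alg_closure) ^ 2 ^ a"
proof (induction a)
  case (Suc a)
  have sq: "(x + y) * (x + y) = x * x + y * y" for x y :: "bit alg_closure"
  proof -
    have "(2 :: bit alg_closure) = 0" by (metis ac_add_self one_add_one)
    then show ?thesis by (simp add: algebra_simps)
  qed
  show ?case
    by (simp only: power_Suc mult.commute[of 2] power_mult Suc power2_eq_square sq)
qed simp

text \<open>A prime with root \<open>z\<close> is its minimal polynomial: a coprime polynomial
  vanishing at \<open>z\<close> would, by Bezout, make 1 vanish there too.\<close>

lemma eval_ac_eq_0_iff:
  assumes "prime q" "eval_ac z q = 0"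
  shows "eval_ac z p = 0 \<longleftrightarrow> q dvd p"
proof
  assume p: "eval_ac z p = 0"
  show "q dvd p"
  proof (rule ccontr)
    assume "\<not> q dvd p"
    then have "gcd q p = 1" using assms prime_imp_coprime by (metis coprime_iff_gcd_eq_1)
    then obtain x y where "x * q + y * p = 1"
      using bezout_coefficients_fst_snd[of q p] by metis
    then have "eval_ac z 1 = eval_ac z (x * q + y * p)" by simp
    then show False using p assms by (simp add: eval_ac_add eval_ac_mult)
  qed
qed (use assms in \<open>auto simp: eval_ac_mult\<close>)

text \<open>Let \<open>z\<close> be a root of \<open>q\<close>. The set \<open>E\<close> of values
  at \<open>z\<close> is the field generated by \<open>z\<close> and has \<open>2 ^ m\<close>
  elements, where \<open>m\<close> is the degree of \<open>q\<close>. Multiplication by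
  \<open>z\<close> permutes \<open>E - {0}\<close>, so the order \<open>d\<close> of
  \<open>z\<close> divides \<open>2 ^ m - 1\<close> and \<open>omega d \<le> m\<close>. Conversely,
  the power \<open>2 ^ omega d\<close> fixes \<open>z\<close> and hence all of \<open>E\<close>, so
  \<open>E\<close> has at most \<open>2 ^ omega d\<close> elements.\<close>

lemma degree_cyc_primes:
  assumes q: "q \<in> cyc_primes d" and "d > 0"
  shows "degree q = omega d"
proof -
  define m where "m = degree q"
  have "prime q" using q by (simp add: cyc_primes_def)
  then have "q \<noteq> 0" "\<not> is_unit q" by (auto dest: not_prime_unit)
  then have "m > 0" unfolding m_def by (simp add: is_unit_iff_degree)
  have "\<exists>z. poly (map_poly to_ac q) z = 0"
    by (rule alg_closed_imp_poly_has_root) (use \<open>m > 0\<close> in \<open>simp add: m_def degree_map_poly\<close>)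
  then obtain z where z: "eval_ac z q = 0" by (auto simp: eval_ac_def)
  note iff = eval_ac_eq_0_iff[OF \<open>prime q\<close> z]
  have cyc: "z ^ j = 1 \<longleftrightarrow> d dvd j" for j
  proof -
    have "z ^ j = 1 \<longleftrightarrow> eval_ac z (cyc j) = 0"
      by (simp add: cyc_def eval_ac_add eval_ac_monom) (metis ac_add_self add_right_cancel)
    with iff cyc_primes_dvd_cyc_iff[OF assms] show ?thesis by simp
  qed
  have "z \<noteq> 0" using cyc[of d] \<open>d > 0\<close> by (metis dvd_refl zero_neq_one power_0_left gr_implies_not0)
  define E where "E = eval_ac z ` polys_below m"
  have inj: "inj_on (eval_ac z) (polys_below m)"
  proof (rule inj_onI)
    fix p p' assume *: "p \<in> polys_below m" "p' \<in> polys_below m" "eval_ac z p = eval_ac z p'"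
    then have "q dvd p + p'" by (simp add: eval_ac_add flip: iff)
    moreover have "p + p' \<in> polys_below m" using * by (simp add: polys_below_def)
    ultimately have "p + p' = 0"
      using \<open>m > 0\<close> by (auto simp: polys_below_iff m_def dest: dvd_imp_degree_le)
    then show "p = p'" by (metis bit_poly_add_self add_right_cancel)
  qed
  have card_E: "card E = 2 ^ m" and fin_E: "finite E"
    by (simp_all add: E_def card_image inj card_polys_below finite_polys_below)
  have eval_in_E: "eval_ac z p \<in> E" for p
  proof -
    have "eval_ac z p = eval_ac z (q * (p div q) + p mod q)" by simp
    also have "\<dots> = eval_ac z (p mod q)"
      unfolding eval_ac_add eval_ac_mult z by simp
    finally have "eval_ac z p = eval_ac z (p mod q)" .
    moreover have "p mod q \<in> polys_below m"
      using degree_mod_less'[of q p] \<open>m > 0\<close> \<open>q \<noteq> 0\<close>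
      by (cases "p mod q = 0") (auto simp: polys_below_iff m_def)
    ultimately show ?thesis by (auto simp: E_def)
  qed
  \<comment> \<open>As in Fermat's little theorem, the product of the nonzero elements is compared
    with itself after multiplying each factor by \<open>z\<close>.\<close>
  have "z ^ (2 ^ m - 1) = 1"
  proof -
    have "(*) z ` (E - {0}) \<subseteq> E - {0}"
    proof
      fix y assume "y \<in> (*) z ` (E - {0})"
      then obtain p where "y = eval_ac z (pCons 0 p)" "y \<noteq> 0"
        using \<open>z \<noteq> 0\<close> by (auto simp: E_def)
      then show "y \<in> E - {0}" using eval_in_E[of "pCons 0 p"] by simp
    qed
    moreover have inj': "inj_on ((*) z) (E - {0})" using \<open>z \<noteq> 0\<close> by (auto simp: inj_on_def)
    ultimately have img: "(*) z ` (E - {0}) = E - {0}"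
      using fin_E by (metis card_image card_subset_eq finite_Diff)
    have "0 \<in> E" using eval_in_E[of 0] by simp
    then have c: "card (E - {0}) = 2 ^ m - 1" using card_E fin_E by simp
    have "\<Prod>(E - {0}) = (\<Prod>y\<in>E - {0}. z * y)"
      using prod.reindex[OF inj', of "\<lambda>y. y"] img by simp
    also have "\<dots> = z ^ (2 ^ m - 1) * \<Prod>(E - {0})" by (simp add: prod.distrib c)
    finally show ?thesis using fin_E by (simp add: prod_zero_iff)
  qed
  then have m: "m \<ge> 1 \<and> d dvd 2 ^ m - 1" using cyc \<open>m > 0\<close> by simp
  then have w: "omega d \<ge> 1" "d dvd 2 ^ omega d - 1" and "omega d \<le> m"
    unfolding omega_def by (metis (mono_tags, lifting) LeastI Least_le)+
  have "2 ^ m \<le> (2 ^ omega d :: nat)"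
  proof -
    \<comment> \<open>In characteristic 2 the roots of \<open>r\<close> are the fixed points of the
      Frobenius map iterated \<open>omega d\<close> times.\<close>
    define r where "r = (monom 1 (2 ^ omega d) + monom 1 1 :: bit alg_closure poly)"
    have "z ^ 2 ^ omega d = z * z ^ (2 ^ omega d - 1)"
      by (metis power_minus_mult mult.commute zero_less_power zero_less_numeral)
    then have zw: "z ^ 2 ^ omega d = z" using w cyc by simp
    have "eval_ac z p ^ 2 ^ omega d = eval_ac z p" for p
    proof (induction p)
      case (pCons a p)
      have "to_ac a ^ 2 ^ omega d = (to_ac a :: bit alg_closure)" by (cases a) simp_all
      with pCons zw show ?case by (simp add: ac_power2_add power_mult_distrib)
    qed simp
    then have "E \<subseteq> {x. poly r x = 0}" by (auto simp: E_def r_def poly_monom)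
    moreover have deg: "degree r = 2 ^ omega d"
    proof -
      have "(1 :: nat) < 2 ^ omega d" using w by (intro one_less_power) auto
      then show ?thesis unfolding r_def by (subst degree_add_eq_left) (simp_all add: degree_monom_eq)
    qed
    moreover from deg have "r \<noteq> 0" by (metis degree_0 power_not_zero zero_neq_numeral)
    ultimately show ?thesis
      using card_mono[OF poly_roots_finite, of r E] card_poly_roots_bound[of r] card_E
      by (metis order_trans)
  qed
  then have "m \<le> omega d" by simp
  with \<open>omega d \<le> m\<close> show ?thesis by (simp add: m_def)
qed

section \<open>The number of irreducible factors of each order and the degrees of divisors\<close>

lemma multiplicity_cyc:
  assumes "odd b" "q \<in> prime_factors (cyc b)"
  shows "multiplicity q (cyc b) = 1"
proof -
  from assms have q: "prime q" "q dvd cyc b" by auto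
  have "b > 0" using assms by (auto intro: Nat.gr0I)
  have "\<not> q ^ 2 dvd cyc b"
  proof
    assume "q ^ 2 dvd cyc b"
    then obtain r where "cyc b = q\<^sup>2 * r" by (elim dvdE)
    then have "cyc b = q * (q * r)" by (simp only: power2_eq_square mult.assoc)
    then have "pderiv (cyc b) = q * (pderiv q * r + pderiv (q * r))"
      by (simp add: pderiv_mult algebra_simps)
    then have "q dvd pderiv (cyc b)" by simp
    also have "pderiv (cyc b) = monom 1 (b - 1)"
      using \<open>odd b\<close> by (simp add: cyc_def pderiv_add pderiv_monom) (metis bit_not_zero_iff even_of_nat_iff even_zero)
    finally have "q dvd monom 1 1 * monom 1 (b - 1)" by (rule dvd_mult)
    then have "q dvd monom 1 b" using \<open>b > 0\<close> by (simp add: mult_monom)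
    with q have "q dvd 1" unfolding cyc_def by (simp add: dvd_add_right_iff)
    with q show False by (auto dest: prime_elem_not_unit prime_imp_prime_elem)
  qed
  moreover have "multiplicity q (cyc b) > 0" using assms by (simp add: prime_factors_multiplicity)
  ultimately show ?thesis using \<open>b > 0\<close> q
    by (metis One_nat_def Suc_lessI Suc_1 less_eq_Suc_le multiplicity_dvd' )
qed

lemma degree_prod_prime_factors:
  fixes f :: "bit poly"
  assumes "f \<noteq> 0" "finite Q" "prime_factors f \<subseteq> Q" "\<And>q. q \<in> Q \<Longrightarrow> prime q"
  shows "degree f = (\<Sum>q\<in>Q. multiplicity q f * degree q)"
proof -
  have "f = (\<Prod>q\<in>prime_factors f. q ^ multiplicity q f)"
    using prod_prime_factors[OF assms(1)] by simp
  also have "\<dots> = (\<Prod>q\<in>Q. q ^ multiplicity q f)"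
    by (rule prod.mono_neutral_left)
      (use assms in \<open>auto simp: prime_factors_multiplicity\<close>)
  finally have "degree f = degree (\<Prod>q\<in>Q. q ^ multiplicity q f)" by simp
  also have "\<dots> = (\<Sum>q\<in>Q. degree (q ^ multiplicity q f))"
    by (rule degree_prod_eq_sum_degree) (use assms in auto)
  also have "\<dots> = (\<Sum>q\<in>Q. multiplicity q f * degree q)"
    by (intro sum.cong degree_power_eq refl) (metis assms(4) not_prime_0)
  finally show ?thesis .
qed

lemma sum_prime_factors_cyc:
  assumes "n > 0"
  shows "(\<Sum>q\<in>prime_factors (cyc n). g q) = (\<Sum>d | d dvd n. \<Sum>q\<in>cyc_primes d. g q)"
  unfolding prime_factors_cyc[OF assms]
proof (rule sum.UNION_disjoint)
  show "finite {d. d dvd n}" using assms by simp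
  show "\<forall>d\<in>{d. d dvd n}. finite (cyc_primes d)"
    using assms by (auto intro: finite_cyc_primes dvd_pos_nat)
  show "\<forall>d\<in>{d. d dvd n}. \<forall>e\<in>{d. d dvd n}. d \<noteq> e \<longrightarrow> cyc_primes d \<inter> cyc_primes e = {}"
    using assms by (intro ballI impI cyc_primes_disjoint) (auto intro: dvd_pos_nat)
qed

text \<open>As \<open>cyc b\<close> is squarefree, its degree \<open>b\<close> is the sum of the
  left-hand sides over all divisors of \<open>b\<close>. The totients have the same sum, so equality
  at the proper divisors forces equality at \<open>b\<close>.\<close>

lemma card_cyc_primes:
  assumes "odd b"
  shows "card (cyc_primes b) * omega b = totient b"
  using assms
proof (induction b rule: less_induct)
  case (less b)
  then have "b > 0" by (auto intro: Nat.gr0I)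
  have "b = degree (cyc b)" by simp
  also have "\<dots> = (\<Sum>q\<in>prime_factors (cyc b). multiplicity q (cyc b) * degree q)"
    by (rule degree_prod_prime_factors) (use \<open>b > 0\<close> in auto)
  also have "\<dots> = (\<Sum>q\<in>prime_factors (cyc b). degree q)"
    by (rule sum.cong) (simp_all add: multiplicity_cyc[OF less.prems])
  also have "\<dots> = (\<Sum>d | d dvd b. \<Sum>q\<in>cyc_primes d. degree q)"
    by (rule sum_prime_factors_cyc) fact
  also have "\<dots> = (\<Sum>d | d dvd b. card (cyc_primes d) * omega d)"
    by (rule sum.cong) (simp_all add: degree_cyc_primes dvd_pos_nat[OF \<open>b > 0\<close>])
  also have "{d. d dvd b} = insert b {d. d dvd b \<and> d < b}"
    using \<open>b > 0\<close> by (auto dest: dvd_imp_le)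
  finally have 1: "b = card (cyc_primes b) * omega b + (\<Sum>d | d dvd b \<and> d < b. card (cyc_primes d) * omega d)"
    by (subst (asm) sum.insert) auto
  have "b = (\<Sum>d | d dvd b. totient d)" by (rule totient_divisor_sum[symmetric])
  also have "{d. d dvd b} = insert b {d. d dvd b \<and> d < b}"
    using \<open>b > 0\<close> by (auto dest: dvd_imp_le)
  finally have 2: "b = totient b + (\<Sum>d | d dvd b \<and> d < b. totient d)"
    by (subst (asm) sum.insert) auto
  have "(\<Sum>d | d dvd b \<and> d < b. card (cyc_primes d) * omega d) = (\<Sum>d | d dvd b \<and> d < b. totient d)"
    by (rule sum.cong) (use less in \<open>auto elim: dvdE\<close>)
  with 1 2 show ?case by linarith
qed

text \<open>Filling greedily works. This spreads a prescribed total multiplicity over the primes of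
  one order, each of which has room for \<open>c\<close>.\<close>

lemma exists_bounded_sum:
  assumes "finite A" "e \<le> c * card A"
  shows "\<exists>g :: 'a \<Rightarrow> nat. (\<forall>x\<in>A. g x \<le> c) \<and> sum g A = e"
  using assms
proof (induction A arbitrary: e)
  case (insert x A)
  have "e - min e c \<le> c * card A" using insert by simp
  from insert.IH[OF this] obtain g where g: "\<forall>y\<in>A. g y \<le> c" "sum g A = e - min e c"
    by blast
  have "sum (g(x := min e c)) A = sum g A" using insert by (intro sum.cong) auto
  with g insert show ?case by (intro exI[of _ "g(x := min e c)"]) auto
qed simp

text \<open>Here \<open>e d\<close> is the total multiplicity in the divisor of the primes of order
  \<open>d\<close>. All of these have degree \<open>omega d\<close>, and each occurs exactly
  \<open>2 ^ a\<close> times in \<open>cyc (2 ^ a * b)\<close>.\<close>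

lemma degree_divisors_cyc:
  assumes "odd b"
  shows "(\<exists>f. f dvd cyc (2 ^ a * b) \<and> degree f = k) \<longleftrightarrow>
    (\<exists>e. (\<forall>d. d dvd b \<longrightarrow> e d \<le> 2 ^ a * card (cyc_primes d)) \<and> k = (\<Sum>d | d dvd b. e d * omega d))"
    (is "?L \<longleftrightarrow> ?R")
proof
  have "b > 0" using assms by (auto intro: Nat.gr0I)
  let ?Q = "prime_factors (cyc b)"
  {
    assume ?L
    then obtain f where f: "f dvd cyc b ^ 2 ^ a" "degree f = k" by (auto simp: cyc_power2)
    have nz: "cyc b ^ 2 ^ a \<noteq> 0" using \<open>b > 0\<close> by simp
    then have "f \<noteq> 0" using f by auto
    have "prime_factors f \<subseteq> ?Q"
    proof
      fix q assume "q \<in> prime_factors f"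
      then have "prime q" "q dvd cyc b ^ 2 ^ a" using f by (auto dest: dvd_trans)
      then show "q \<in> ?Q"
        using \<open>b > 0\<close> by (auto simp: in_prime_factors_iff dest: prime_elem_dvd_power)
    qed
    then have "k = (\<Sum>q\<in>?Q. multiplicity q f * degree q)"
      using degree_prod_prime_factors[OF \<open>f \<noteq> 0\<close>, of ?Q] f by auto
    also have "\<dots> = (\<Sum>d | d dvd b. \<Sum>q\<in>cyc_primes d. multiplicity q f * degree q)"
      by (rule sum_prime_factors_cyc) fact
    also have "\<dots> = (\<Sum>d | d dvd b. (\<Sum>q\<in>cyc_primes d. multiplicity q f) * omega d)"
      unfolding sum_distrib_right
      by (intro sum.cong refl) (simp_all add: degree_cyc_primes dvd_pos_nat[OF \<open>b > 0\<close>])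
    finally have k: "k = (\<Sum>d | d dvd b. (\<Sum>q\<in>cyc_primes d. multiplicity q f) * omega d)" .
    have "(\<Sum>q\<in>cyc_primes d. multiplicity q f) \<le> 2 ^ a * card (cyc_primes d)" if "d dvd b" for d
    proof -
      have "multiplicity q f \<le> 2 ^ a" if "q \<in> cyc_primes d" for q
      proof -
        have q: "q \<in> ?Q" using that \<open>d dvd b\<close> \<open>b > 0\<close> by (auto simp: prime_factors_cyc)
        have "multiplicity q f \<le> multiplicity q (cyc b ^ 2 ^ a)"
          using f(1) nz by (rule dvd_imp_multiplicity_le)
        also have "\<dots> = 2 ^ a * multiplicity q (cyc b)"
          by (rule prime_elem_multiplicity_power_distrib) (use q \<open>b > 0\<close> in \<open>auto intro: prime_imp_prime_elem\<close>)
        finally show ?thesis using multiplicity_cyc[OF assms q] by simp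
      qed
      then show ?thesis using sum_bounded_above[of "cyc_primes d" "\<lambda>q. multiplicity q f" "2 ^ a"]
        by (simp add: mult.commute)
    qed
    with k show ?R
      by (intro exI[of _ "\<lambda>d. \<Sum>q\<in>cyc_primes d. multiplicity q f"]) simp
  }
  {
    assume ?R
    then obtain e where e: "\<And>d. d dvd b \<Longrightarrow> e d \<le> 2 ^ a * card (cyc_primes d)"
      and k: "k = (\<Sum>d | d dvd b. e d * omega d)" by blast
    have "\<exists>g. (\<forall>q\<in>cyc_primes d. g q \<le> 2 ^ a) \<and> sum g (cyc_primes d) = e d" if "d dvd b" for d
      by (rule exists_bounded_sum) (use e that in \<open>auto intro!: finite_cyc_primes dvd_pos_nat[OF \<open>b > 0\<close>]\<close>)
    then obtain g where g: "\<And>d q. d dvd b \<Longrightarrow> q \<in> cyc_primes d \<Longrightarrow> g d q \<le> 2 ^ a"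
      "\<And>d. d dvd b \<Longrightarrow> sum (g d) (cyc_primes d) = e d"
      by metis
    \<comment> \<open>The prime \<open>q\<close> determines its order \<open>d\<close>, so the
      exponents chosen separately for each order combine into one function.\<close>
    define h where "h q = g (THE d. d dvd b \<and> q \<in> cyc_primes d) q" for q
    have h: "h q = g d q" if "d dvd b" "q \<in> cyc_primes d" for d q
    proof -
      have "(THE d. d dvd b \<and> q \<in> cyc_primes d) = d"
      proof (rule the_equality)
        fix d' assume "d' dvd b \<and> q \<in> cyc_primes d'"
        then show "d' = d"
          using that cyc_primes_disjoint[of d' d] dvd_pos_nat[OF \<open>b > 0\<close>] by (meson disjoint_iff)
      qed (use that in simp)
      then show ?thesis by (simp add: h_def)
    qed
    define f where "f = (\<Prod>q\<in>?Q. q ^ h q)"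
    have "cyc b = (\<Prod>q\<in>?Q. q ^ multiplicity q (cyc b))"
      using prod_prime_factors[of "cyc b"] \<open>b > 0\<close> by simp
    also have "\<dots> = \<Prod>?Q" by (rule prod.cong) (simp_all add: multiplicity_cyc[OF assms])
    finally have "cyc b ^ 2 ^ a = \<Prod>?Q ^ 2 ^ a" by (rule arg_cong)
    also have "\<dots> = (\<Prod>q\<in>?Q. q ^ 2 ^ a)" by (rule prod_power_distrib)
    finally have "cyc (2 ^ a * b) = (\<Prod>q\<in>?Q. q ^ 2 ^ a)" by (simp only: cyc_power2)
    moreover have "f dvd (\<Prod>q\<in>?Q. q ^ 2 ^ a)"
      unfolding f_def
    proof (rule prod_dvd_prod)
      fix q assume "q \<in> ?Q"
      then obtain d where "d dvd b" "q \<in> cyc_primes d" using \<open>b > 0\<close> by (auto simp: prime_factors_cyc)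
      then show "q ^ h q dvd q ^ 2 ^ a" using g h by (simp add: le_imp_power_dvd)
    qed
    moreover have "degree f = k"
    proof -
      have "degree f = (\<Sum>q\<in>?Q. degree (q ^ h q))"
        unfolding f_def by (rule degree_prod_eq_sum_degree) auto
      also have "\<dots> = (\<Sum>q\<in>?Q. h q * degree q)"
        by (intro sum.cong degree_power_eq refl) (metis in_prime_factors_imp_prime not_prime_0)
      also have "\<dots> = (\<Sum>d | d dvd b. \<Sum>q\<in>cyc_primes d. h q * degree q)"
        by (rule sum_prime_factors_cyc) fact
      also have "\<dots> = (\<Sum>d | d dvd b. \<Sum>q\<in>cyc_primes d. g d q * omega d)"
        by (intro sum.cong refl) (simp_all add: degree_cyc_primes h dvd_pos_nat[OF \<open>b > 0\<close>])
      also have "\<dots> = k" unfolding k by (simp add: g flip: sum_distrib_right)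
      finally show ?thesis .
    qed
    ultimately show ?L by (intro exI[of _ f]) simp
  }
qed

section \<open>Cyclic codes\<close>

text \<open>Functions on the integers modulo \<open>n\<close> are represented on all integers, so
  that shifts and reversals need no reduction of the index.\<close>

definition periodic :: "nat \<Rightarrow> (int \<Rightarrow> bit) \<Rightarrow> bool" where
  "periodic n x \<longleftrightarrow> (\<forall>i. x (i + int n) = x i)"

lemma periodic_mult: "periodic n x \<Longrightarrow> x (i + int n * m) = x i"
proof (induction m rule: int_induct[where k = 0])
  case (step1 m)
  then show ?case
    unfolding periodic_def by (metis add.assoc distrib_left mult.right_neutral)
next
  case (step2 m)
  have "x (i + int n * (m - 1)) = x (i + int n * (m - 1) + int n)"
    using step2.prems by (simp add: periodic_def)
  also have "i + int n * (m - 1) + int n = i + int n * m" by (simp add: algebra_simps)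
  finally show ?case using step2 by simp
qed simp

lemma periodic_cong:
  assumes "periodic n x" "[i = j] (mod int n)"
  shows "x i = x j"
proof -
  obtain m where "i = j + int n * m" using assms(2) by (metis cong_iff_lin cong_sym)
  then show ?thesis using periodic_mult[OF assms(1)] by simp
qed

lemma seq_add_self [simp]: "x + x = (0 :: int \<Rightarrow> bit)"
  by (rule ext) simp

lemma seq_add_self_left [simp]: "x + (x + y) = (y :: int \<Rightarrow> bit)"
  by (simp flip: add.assoc)

text \<open>Over the field with two elements, closure under addition already makes a
  subspace.\<close>

definition linear_code :: "(int \<Rightarrow> bit) set \<Rightarrow> bool" where
  "linear_code C \<longleftrightarrow> 0 \<in> C \<and> (\<forall>x\<in>C. \<forall>y\<in>C. x + y \<in> C)"

text \<open>Each fibre over the image is a translate of the kernel.\<close>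

lemma card_additive_hom:
  fixes \<phi> :: "(int \<Rightarrow> bit) \<Rightarrow> (int \<Rightarrow> bit)"
  assumes "finite C" "linear_code C" and hom: "\<And>x y. \<phi> (x + y) = \<phi> x + \<phi> y"
  shows "card C = card (\<phi> ` C) * card {x \<in> C. \<phi> x = 0}"
proof -
  have "card {x \<in> C. \<phi> x = y} = card {x \<in> C. \<phi> x = 0}" if "y \<in> \<phi> ` C" for y
  proof -
    from that obtain c where c: "c \<in> C" "\<phi> c = y" by blast
    have "bij_betw ((+) c) {x \<in> C. \<phi> x = 0} {x \<in> C. \<phi> x = y}"
      by (rule bij_betwI[where g = "(+) c"])
        (use c assms(2) in \<open>auto simp: linear_code_def hom\<close>)
    from bij_betw_same_card[OF this] show ?thesis by simp
  qed
  then have "(\<Sum>y\<in>\<phi> ` C. card {x \<in> C. \<phi> x = y}) = card (\<phi> ` C) * card {x \<in> C. \<phi> x = 0}" by simp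
  moreover have "card C = (\<Sum>y\<in>\<phi> ` C. card {x \<in> C. \<phi> x = y})"
    using sum.image_gen[OF assms(1), of "\<lambda>_. 1 :: nat" \<phi>] by simp
  ultimately show ?thesis by simp
qed

text \<open>The reversed indexing makes the shift \<open>\<lambda>i. x (i + 1)\<close> correspond to multiplication by the variable.\<close>

definition seq_poly :: "nat \<Rightarrow> (int \<Rightarrow> bit) \<Rightarrow> bit poly" where
  "seq_poly n x = (\<Sum>i<n. monom (x (- int i)) i)"

lemma coeff_seq_poly: "coeff (seq_poly n x) i = (if i < n then x (- int i) else 0)"
  by (simp add: seq_poly_def coeff_sum if_distrib cong: if_cong)

lemma seq_poly_in_polys_below: "seq_poly n x \<in> polys_below n"
  by (simp add: polys_below_def coeff_seq_poly)

lemma seq_poly_add: "seq_poly n (x + y) = seq_poly n x + seq_poly n y"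
  by (rule poly_eqI) (simp add: coeff_seq_poly)

lemma inj_seq_poly:
  assumes "n > 0"
  shows "inj_on (seq_poly n) {x. periodic n x}"
proof (rule inj_onI, rule ext)
  fix x y i assume x: "x \<in> {x. periodic n x}" and y: "y \<in> {x. periodic n x}" and eq: "seq_poly n x = seq_poly n y"
  define j where "j = nat ((- i) mod int n)"
  have j: "int j = (- i) mod int n" "j < n" using assms by (auto simp: j_def nat_less_iff)
  then have "[i = - int j] (mod int n)"
    by (metis cong_minus_minus_iff cong_mod_right cong_refl minus_minus)
  moreover have "x (- int j) = y (- int j)"
    using arg_cong[OF eq, of "\<lambda>p. coeff p j"] j by (simp add: coeff_seq_poly)
  ultimately show "x i = y i" using x y periodic_cong by (metis mem_Collect_eq)
qed

lemma finite_periodic: "n > 0 \<Longrightarrow> finite {x. periodic n x}"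
  by (rule inj_on_finite[OF inj_seq_poly _ finite_polys_below[of n]])
    (auto intro: seq_poly_in_polys_below)

text \<open>Modulo \<open>cyc n\<close>, multiplication by the variable is the shift: the
  coefficient pushed up to degree \<open>n\<close> is \<open>x (1 - n) = x 1\<close>, and it returns
  as the constant term.\<close>

lemma pCons_seq_poly:
  assumes "periodic n x" "n > 0"
  shows "pCons 0 (seq_poly n x) = seq_poly n (\<lambda>i. x (i + 1)) + smult (x 1) (cyc n)"
proof (rule poly_eqI)
  fix i
  have "x (1 - int n) = x 1" using assms(1) by (metis diff_add_cancel periodic_def)
  then have *: "x (- int j) = x 1" if "Suc j = n" for j using that by auto
  then show "coeff (pCons 0 (seq_poly n x)) i = coeff (seq_poly n (\<lambda>i. x (i + 1)) + smult (x 1) (cyc n)) i"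
    using assms(2) by (cases i) (auto simp: coeff_pCons coeff_seq_poly cyc_def algebra_simps intro!: *)
qed

lemma mod_polys_below: "n > 0 \<Longrightarrow> p \<in> polys_below n \<Longrightarrow> p mod cyc n = p"
  by (simp add: polys_below_iff mod_poly_less)

text \<open>The polynomials congruent to code words modulo \<open>cyc n\<close> form an ideal
  \<open>J\<close>. With \<open>g\<close> a generator, the code consists of the multiples of
  \<open>g\<close> of degree below \<open>n\<close>, so its dimension is the degree of the cofactor
  \<open>f\<close> of \<open>g\<close> in \<open>cyc n\<close>.\<close>

lemma card_cyclic_code:
  assumes "n > 0" "linear_code C" and per: "\<And>x. x \<in> C \<Longrightarrow> periodic n x"
    and shift: "\<And>x. x \<in> C \<Longrightarrow> (\<lambda>i. x (i + 1)) \<in> C"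
  shows "\<exists>f. f dvd cyc n \<and> card C = 2 ^ degree f"
proof -
  define J where "J = {p. p mod cyc n \<in> seq_poly n ` C}"
  have J_add: "p + q \<in> J" if "p \<in> J" "q \<in> J" for p q
  proof -
    from that obtain x y where "x \<in> C" "y \<in> C" "p mod cyc n = seq_poly n x" "q mod cyc n = seq_poly n y"
      by (auto simp: J_def)
    then have "(p + q) mod cyc n = seq_poly n (x + y)" "x + y \<in> C"
      using \<open>linear_code C\<close> by (simp_all add: poly_mod_add_left seq_poly_add linear_code_def)
    then show ?thesis by (simp add: J_def)
  qed
  have "seq_poly n 0 = 0" by (rule poly_eqI) (simp add: coeff_seq_poly)
  then have "0 \<in> seq_poly n ` C" using \<open>linear_code C\<close> by (metis linear_code_def imageI)
  then have J_0: "0 \<in> J" and J_cyc: "cyc n \<in> J" by (simp_all add: J_def)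
  have J_pCons: "pCons 0 p \<in> J" if "p \<in> J" for p
  proof -
    from that obtain x where x: "x \<in> C" "p mod cyc n = seq_poly n x" by (auto simp: J_def)
    have "pCons 0 p mod cyc n = ([:0, 1:] * p) mod cyc n" by simp
    also have "\<dots> = ([:0, 1:] * (p mod cyc n)) mod cyc n" by (simp only: mod_mult_right_eq)
    also have "\<dots> = pCons 0 (seq_poly n x) mod cyc n" using x by simp
    also have "\<dots> = seq_poly n (\<lambda>i. x (i + 1)) mod cyc n"
      using pCons_seq_poly[OF per[OF x(1)] \<open>n > 0\<close>] by (simp add: poly_mod_add_left mod_smult_left)
    also have "\<dots> = seq_poly n (\<lambda>i. x (i + 1))"
      by (rule mod_polys_below) (use \<open>n > 0\<close> seq_poly_in_polys_below in auto)
    finally show ?thesis using shift[OF x(1)] by (simp add: J_def)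
  qed
  have J_mult: "r * p \<in> J" if "p \<in> J" for r p
  proof (induction r)
    case (pCons a r)
    have "smult a p \<in> J" using that J_0 by (cases a) simp_all
    then show ?case using pCons J_pCons J_add by simp
  qed (simp add: J_0)
  obtain g where g: "g \<in> J" "g \<noteq> 0" and min: "\<And>p. p \<in> J \<Longrightarrow> p \<noteq> 0 \<Longrightarrow> degree g \<le> degree p"
    using ex_has_least_nat[of "\<lambda>p. p \<in> J \<and> p \<noteq> 0" "cyc n" degree] J_cyc \<open>n > 0\<close> by auto
  have g_dvd: "g dvd p" if "p \<in> J" for p
  proof -
    have "p + p div g * g = p mod g"
      by (metis bit_poly_add_self_left div_mult_mod_eq add.commute add.left_commute)
    then have "p mod g \<in> J" using J_add J_mult that g by metis
    then have "p mod g = 0" using min degree_mod_less[OF g(2), of p] by (metis not_le)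
    then show ?thesis by (simp add: dvd_eq_mod_eq_0)
  qed
  then obtain f where f: "cyc n = g * f" using J_cyc by (metis dvdE)
  then have "f \<noteq> 0" using \<open>n > 0\<close> by (metis cyc_eq_0_iff mult_zero_right not_gr0)
  have deg: "n = degree g + degree f"
    using degree_mult_eq[OF g(2) \<open>f \<noteq> 0\<close>] by (simp flip: f)
  have "seq_poly n ` C = (*) g ` polys_below (degree f)"
  proof (intro subset_antisym subsetI)
    fix p assume p: "p \<in> seq_poly n ` C"
    then have p': "p \<in> polys_below n" using seq_poly_in_polys_below by auto
    then have "p \<in> J" using p \<open>n > 0\<close> by (simp add: J_def mod_polys_below)
    then obtain h where h: "p = g * h" using g_dvd by (metis dvdE)
    have "h \<in> polys_below (degree f)"
    proof (cases "h = 0")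
      case False
      then have "degree h < degree f"
        using p' h deg \<open>n > 0\<close> g by (simp add: polys_below_iff degree_mult_eq)
      then show ?thesis by (subst polys_below_iff) auto
    qed (simp add: polys_below_def)
    with h show "p \<in> (*) g ` polys_below (degree f)" by blast
  next
    fix p assume "p \<in> (*) g ` polys_below (degree f)"
    then obtain h where h: "p = g * h" "h \<in> polys_below (degree f)" by auto
    have "p \<in> J" using J_mult[OF g(1), of h] h by (simp add: mult.commute)
    moreover have "p \<in> polys_below n"
    proof (cases "h = 0")
      case False
      then have "degree f > 0"
        using h(2) by (intro gr0I) (simp add: polys_below_def poly_eq_iff)
      then show ?thesis
        using h deg \<open>n > 0\<close> g False by (simp add: polys_below_iff degree_mult_eq)
    qed (simp add: polys_below_def h)
    ultimately show "p \<in> seq_poly n ` C" using \<open>n > 0\<close> by (simp add: J_def mod_polys_below)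
  qed
  moreover have "card (seq_poly n ` C) = card C"
    by (rule card_image, rule inj_on_subset[OF inj_seq_poly]) (use per \<open>n > 0\<close> in auto)
  moreover have "card ((*) g ` polys_below (degree f)) = 2 ^ degree f"
    by (subst card_image) (use g in \<open>auto simp: inj_on_def card_polys_below\<close>)
  ultimately have "card C = 2 ^ degree f" by simp
  with f show ?thesis by (metis dvd_triv_right)
qed

text \<open>For odd \<open>n\<close>, iterating the double shift gives the single shift. For
  \<open>n = 2 * m\<close>, the words vanishing at odd positions and the restrictions of all words
  to odd positions give two cyclic codes of length \<open>m\<close>. The sizes multiply to that of
  \<open>C\<close>, and the product of the two divisors of \<open>cyc m\<close> divides its square
  \<open>cyc n\<close>.\<close>

lemma card_cyclic_code2:
  assumes "n > 0" "linear_code C" and per: "\<And>x. x \<in> C \<Longrightarrow> periodic n x"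
    and shift: "\<And>x. x \<in> C \<Longrightarrow> (\<lambda>i. x (i + 2)) \<in> C"
  shows "\<exists>f. f dvd cyc n \<and> card C = 2 ^ degree f"
proof (cases "even n")
  case False
  have "(\<lambda>i. x (i + 2 * int m)) \<in> C" if "x \<in> C" for x m
  proof (induction m)
    case (Suc m)
    from shift[OF Suc] show ?case by (simp add: algebra_simps)
  qed (simp add: that)
  note iter = this
  have "(\<lambda>i. x (i + 1)) \<in> C" if "x \<in> C" for x
  proof -
    have "x (i + 2 * int ((n + 1) div 2)) = x (i + 1)" for i
    proof -
      have "2 * int ((n + 1) div 2) = int n + 1" using False by (auto elim!: oddE)
      then have "i + 2 * int ((n + 1) div 2) = (i + 1) + int n" by simp
      then show ?thesis using per[OF that] by (simp only: periodic_def)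
    qed
    with iter[OF that, of "(n + 1) div 2"] show ?thesis by simp
  qed
  with assms show ?thesis by (intro card_cyclic_code)
next
  case True
  then obtain m where m: "n = 2 * m" by blast
  then have "m > 0" using \<open>n > 0\<close> by simp
  define C0 where "C0 = {x \<in> C. (\<lambda>i. x (2 * i + 1)) = 0}"
  define Ev where "Ev = (\<lambda>(x :: int \<Rightarrow> bit) i. x (2 * i))"
  define Od where "Od = (\<lambda>(x :: int \<Rightarrow> bit) i. x (2 * i + 1))"
  have fin: "finite C"
    by (rule finite_subset[OF _ finite_periodic[OF \<open>n > 0\<close>]]) (use per in auto)
  have "linear_code C0"
    using \<open>linear_code C\<close> by (auto simp: linear_code_def C0_def fun_eq_iff)
  have per': "periodic m (Ev x)" "periodic m (Od x)" if "x \<in> C" for x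
    using per[OF that] by (auto simp: periodic_def Ev_def Od_def m algebra_simps)
       (metis (no_types, lifting) add.assoc add.commute)+
  have "\<exists>f. f dvd cyc m \<and> card (Ev ` C0) = 2 ^ degree f"
  proof (rule card_cyclic_code[OF \<open>m > 0\<close>])
    show "linear_code (Ev ` C0)" unfolding linear_code_def
    proof (intro conjI ballI)
      show "0 \<in> Ev ` C0" using \<open>linear_code C0\<close> by (auto simp: linear_code_def Ev_def intro!: image_eqI[of _ _ 0])
      fix x y assume "x \<in> Ev ` C0" "y \<in> Ev ` C0"
      then obtain x' y' where "x' \<in> C0" "y' \<in> C0" "x = Ev x'" "y = Ev y'" by auto
      then have "x' + y' \<in> C0" "x + y = Ev (x' + y')" using \<open>linear_code C0\<close>
        by (auto simp: linear_code_def Ev_def)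
      then show "x + y \<in> Ev ` C0" by blast
    qed
    show "periodic m x" if "x \<in> Ev ` C0" for x using that per' by (auto simp: C0_def)
    show "(\<lambda>i. x (i + 1)) \<in> Ev ` C0" if x: "x \<in> Ev ` C0" for x
    proof -
      obtain x' where x': "x' \<in> C0" "x = Ev x'" using x by auto
      have "(\<lambda>i. x' (i + 2)) \<in> C0"
      proof -
        have "(\<lambda>i. x' (2 * i + 1)) = 0" using x' by (simp add: C0_def)
        from fun_cong[OF this] have "x' (2 * (i + 1) + 1) = 0" for i by (rule trans) simp
        then have "(\<lambda>i. x' (2 * i + 1 + 2)) = 0" by (simp add: algebra_simps fun_eq_iff)
        then show ?thesis using x' shift by (simp add: C0_def)
      qed
      moreover have "(\<lambda>i. x (i + 1)) = Ev (\<lambda>i. x' (i + 2))" by (simp add: x' Ev_def algebra_simps)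
      ultimately show ?thesis by blast
    qed
  qed
  then obtain f where f: "f dvd cyc m" "card (Ev ` C0) = 2 ^ degree f" by blast
  have "\<exists>f. f dvd cyc m \<and> card (Od ` C) = 2 ^ degree f"
  proof (rule card_cyclic_code[OF \<open>m > 0\<close>])
    show "linear_code (Od ` C)" unfolding linear_code_def
    proof (intro conjI ballI)
      show "0 \<in> Od ` C" using \<open>linear_code C\<close> by (auto simp: linear_code_def Od_def intro!: image_eqI[of _ _ 0])
      fix x y assume "x \<in> Od ` C" "y \<in> Od ` C"
      then obtain x' y' where "x' \<in> C" "y' \<in> C" "x = Od x'" "y = Od y'" by auto
      then have "x' + y' \<in> C" "x + y = Od (x' + y')" using \<open>linear_code C\<close>
        by (auto simp: linear_code_def Od_def)
      then show "x + y \<in> Od ` C" by blast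
    qed
    show "periodic m x" if "x \<in> Od ` C" for x using that per' by auto
    show "(\<lambda>i. x (i + 1)) \<in> Od ` C" if x: "x \<in> Od ` C" for x
    proof -
      obtain x' where x': "x' \<in> C" "x = Od x'" using x by auto
      moreover have "(\<lambda>i. x (i + 1)) = Od (\<lambda>i. x' (i + 2))" by (simp add: x' Od_def algebra_simps)
      ultimately show ?thesis using shift by blast
    qed
  qed
  then obtain h where h: "h dvd cyc m" "card (Od ` C) = 2 ^ degree h" by blast
  have "inj_on Ev C0"
  proof (rule inj_onI, rule ext)
    fix x y i assume *: "x \<in> C0" "y \<in> C0" "Ev x = Ev y"
    show "x i = y i"
    proof (cases "even i")
      case True
      then show ?thesis using fun_cong[OF *(3), of "i div 2"] by (simp add: Ev_def)
    next
      case False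
      then have "i = 2 * (i div 2) + 1" by simp
      then show ?thesis using * by (metis (mono_tags, lifting) C0_def mem_Collect_eq)
    qed
  qed
  then have "card C0 = 2 ^ degree f" using f by (simp add: card_image)
  moreover have "card C = card (Od ` C) * card {x \<in> C. Od x = 0}"
    by (rule card_additive_hom[OF fin \<open>linear_code C\<close>]) (auto simp: Od_def)
  moreover have "{x \<in> C. Od x = 0} = C0" by (simp add: C0_def Od_def)
  ultimately have "card C = 2 ^ (degree f + degree h)" using h by (simp add: power_add)
  moreover have "cyc m \<noteq> 0" using \<open>m > 0\<close> by simp
  then have "f \<noteq> 0" "h \<noteq> 0" using f h by auto
  then have "degree (f * h) = degree f + degree h" by (rule degree_mult_eq)
  moreover have "f * h dvd cyc n"
    using mult_dvd_mono[OF f(1) h(1)] cyc_power2[of m 1] by (simp add: m power2_eq_square)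
  ultimately show ?thesis by metis
qed

section \<open>Linear recurrences\<close>

text \<open>Sequences form a module over the polynomials, with the variable acting as the shift; the
  kernel of \<open>f\<close> is the solution space of a linear recurrence.\<close>

definition poly_act :: "bit poly \<Rightarrow> (nat \<Rightarrow> bit) \<Rightarrow> nat \<Rightarrow> bit" where
  "poly_act p x i = (\<Sum>j\<le>degree p. coeff p j * x (i + j))"

lemma poly_act_eq: "degree p \<le> N \<Longrightarrow> poly_act p x i = (\<Sum>j\<le>N. coeff p j * x (i + j))"
  unfolding poly_act_def by (rule sum.mono_neutral_left) (auto simp: coeff_eq_0)

lemma poly_act_0 [simp]: "poly_act 0 x i = 0"
  by (simp add: poly_act_def)

lemma poly_act_pCons: "poly_act (pCons a p) x i = a * x i + poly_act p x (Suc i)"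
proof -
  have "poly_act (pCons a p) x i = (\<Sum>j\<le>Suc (degree p). coeff (pCons a p) j * x (i + j))"
    by (rule poly_act_eq) (simp add: degree_pCons_le)
  also have "\<dots> = a * x i + poly_act p x (Suc i)"
    by (simp add: sum.atMost_Suc_shift poly_act_def del: sum.atMost_Suc)
  finally show ?thesis .
qed

lemma poly_act_add: "poly_act (p + q) x i = poly_act p x i + poly_act q x i"
  by (induction p q arbitrary: i rule: poly_induct2) (simp_all add: poly_act_pCons algebra_simps)

lemma poly_act_monom: "poly_act (monom 1 n) x i = x (i + n)"
  by (induction n arbitrary: i) (simp_all add: monom_0 monom_Suc poly_act_pCons)

lemma poly_act_seq_add: "poly_act p (\<lambda>i. x i + y i) i = poly_act p x i + poly_act p y i"
  by (simp add: poly_act_def distrib_left sum.distrib)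

lemma poly_act_shift: "poly_act p (\<lambda>i. x (i + m)) i = poly_act p x (i + m)"
  by (simp add: poly_act_def algebra_simps)

lemma poly_act_mult_eq_0: "(\<And>i. poly_act q x i = 0) \<Longrightarrow> poly_act (p * q) x i = 0"
proof (induction p arbitrary: i)
  case (pCons a p)
  then show ?case by (cases a) (simp_all add: poly_act_add poly_act_pCons)
qed simp

definition recurrent :: "bit poly \<Rightarrow> (nat \<Rightarrow> bit) set" where
  "recurrent f = {x. \<forall>i. poly_act f x i = 0}"

lemma recurrent_add: "x \<in> recurrent f \<Longrightarrow> y \<in> recurrent f \<Longrightarrow> (\<lambda>i. x i + y i) \<in> recurrent f"
  by (simp add: recurrent_def poly_act_seq_add)

lemma recurrent_shift: "x \<in> recurrent f \<Longrightarrow> (\<lambda>i. x (i + m)) \<in> recurrent f"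
  by (simp add: recurrent_def poly_act_shift)

lemma recurrent_0: "(\<lambda>_. 0) \<in> recurrent f"
  by (simp add: recurrent_def poly_act_def)

lemma bit_add_eq_0_iff: "x + y = (0 :: bit) \<longleftrightarrow> x = y"
  by (cases x; cases y) simp_all

text \<open>A multiple of \<open>f\<close> annihilates \<open>x\<close> too, and
  \<open>cyc n\<close> acts as the \<open>n\<close>-fold shift plus the identity.\<close>

lemma recurrent_periodic:
  assumes "f dvd cyc n" "x \<in> recurrent f"
  shows "x (i + n) = x i"
proof -
  obtain g where "cyc n = g * f" using assms(1) by (metis dvdE mult.commute)
  then have "poly_act (cyc n) x i = 0" using assms(2) by (simp add: poly_act_mult_eq_0 recurrent_def)
  then show ?thesis
    by (simp add: cyc_def poly_act_add poly_act_monom one_pCons poly_act_pCons bit_add_eq_0_iff)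
qed

lemma recurrent_mod:
  assumes "f dvd cyc n" "x \<in> recurrent f"
  shows "x (i + m mod n) = x (i + m)"
proof -
  have "x (j + n * l) = x j" for j l
  proof (induction l)
    case (Suc l)
    have "x (j + n * Suc l) = x (j + n * l + n)" by (simp add: algebra_simps)
    then show ?case using recurrent_periodic[OF assms] Suc by simp
  qed simp
  from this[of "i + m mod n" "m div n"] show ?thesis by (simp add: add.assoc)
qed

lemma bit_poly_coeff_degree: "f \<noteq> 0 \<Longrightarrow> coeff f (degree f) = (1 :: bit)"
  by (metis bit_not_one_iff leading_coeff_0_iff)

lemma recurrent_iff:
  assumes "f \<noteq> 0" "degree f = k"
  shows "x \<in> recurrent f \<longleftrightarrow> (\<forall>i. x (i + k) = (\<Sum>j<k. coeff f j * x (i + j)))"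
proof -
  have "poly_act f x i = (\<Sum>j<k. coeff f j * x (i + j)) + x (i + k)" for i
    using bit_poly_coeff_degree[OF assms(1)] assms(2)
    by (simp add: poly_act_def lessThan_Suc_atMost[symmetric])
  then show ?thesis by (auto simp: recurrent_def bit_add_eq_0_iff)
qed

lemma recurrent_eqI:
  assumes "f \<noteq> 0" "degree f = k" "x \<in> recurrent f" "y \<in> recurrent f" "\<And>i. i < k \<Longrightarrow> x i = y i"
  shows "x = y"
proof
  fix i show "x i = y i"
  proof (induction i rule: less_induct)
    case (less i)
    show ?case
    proof (cases "i < k")
      case False
      then have i: "i = i - k + k" by simp
      have "x (i - k + k) = (\<Sum>j<k. coeff f j * x (i - k + j))"
        using assms(3) recurrent_iff[OF assms(1,2)] by blast
      also have "\<dots> = (\<Sum>j<k. coeff f j * y (i - k + j))"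
        by (rule sum.cong) (use less False in auto)
      also have "\<dots> = y (i - k + k)"
        using assms(4) recurrent_iff[OF assms(1,2)] by metis
      finally show ?thesis by (simp flip: i)
    qed (use assms in auto)
  qed
qed

text \<open>When \<open>f\<close> has degree \<open>length xs\<close>, this continues any initial
  list to a solution, and \<open>recurrent_eqI\<close> gives uniqueness; so solutions correspond to
  windows of length \<open>k\<close>.\<close>

function recurrence :: "bit poly \<Rightarrow> bit list \<Rightarrow> nat \<Rightarrow> bit" where
  "recurrence f xs i = (if i < length xs then xs ! i
    else \<Sum>j<length xs. coeff f j * recurrence f xs (i - length xs + j))"
  by pat_completeness auto
termination by (relation "measure (\<lambda>(_, _, i). i)") auto

declare recurrence.simps [simp del]

lemma recurrence_recurrent:
  assumes "f \<noteq> 0" "degree f = length xs"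
  shows "recurrence f xs \<in> recurrent f"
  unfolding recurrent_iff[OF assms]
proof
  fix i show "recurrence f xs (i + length xs) = (\<Sum>j<length xs. coeff f j * recurrence f xs (i + j))"
    by (subst recurrence.simps) simp
qed

lemma recurrence_nth: "i < length xs \<Longrightarrow> recurrence f xs i = xs ! i"
  by (subst recurrence.simps) simp

lemma map_recurrence: "map (recurrence f xs) [0..<length xs] = xs"
  by (rule nth_equalityI) (simp_all add: recurrence_nth)

section \<open>A regular group from a divisor of t^n - 1\<close>

definition recurrence_group :: "nat \<Rightarrow> bit poly \<Rightarrow> (nat \<times> (nat \<Rightarrow> bit)) monoid" where
  \<comment> \<open>The semidirect product of the solution space with the cyclic shifts. The element
    \<open>(i, x)\<close> will stand for the vertex in fibre \<open>i\<close> whose word is the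
    first \<open>k\<close> terms of \<open>x\<close>, so left multiplication by
    \<open>(1, y)\<close> moves the window by one and adds \<open>y\<close>.\<close>
  "recurrence_group n f = \<lparr> carrier = {..<n} \<times> recurrent f,
     mult = (\<lambda>(j, y) (i, x). ((i + j) mod n, \<lambda>p. x (p + j) + y p)), one = (0, \<lambda>_. 0) \<rparr>"

lemma group_recurrence_group:
  assumes "f dvd cyc n" "n > 0"
  shows "group (recurrence_group n f)"
proof (rule groupI)
  note [simp] = recurrence_group_def
  note [simp] = recurrent_mod[OF assms(1)]
  fix g h assume "g \<in> carrier (recurrence_group n f)" "h \<in> carrier (recurrence_group n f)"
  then show "g \<otimes>\<^bsub>recurrence_group n f\<^esub> h \<in> carrier (recurrence_group n f)"
    using \<open>n > 0\<close> by (auto intro: recurrent_add recurrent_shift)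
next
  fix g h l assume "g \<in> carrier (recurrence_group n f)" "h \<in> carrier (recurrence_group n f)"
    "l \<in> carrier (recurrence_group n f)"
  then show "g \<otimes>\<^bsub>recurrence_group n f\<^esub> h \<otimes>\<^bsub>recurrence_group n f\<^esub> l =
    g \<otimes>\<^bsub>recurrence_group n f\<^esub> (h \<otimes>\<^bsub>recurrence_group n f\<^esub> l)"
    by (auto simp: recurrence_group_def recurrent_mod[OF assms(1)] fun_eq_iff mod_simps algebra_simps)
next
  fix g assume "g \<in> carrier (recurrence_group n f)"
  then obtain i x where g: "g = (i, x)" "i < n" "x \<in> recurrent f" by (auto simp: recurrence_group_def)
  show "\<one>\<^bsub>recurrence_group n f\<^esub> \<otimes>\<^bsub>recurrence_group n f\<^esub> g = g"
    using g by (simp add: recurrence_group_def)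
  have "(\<lambda>p. x (p + n - i)) \<in> recurrent f" using recurrent_shift[OF g(3), of "n - i"] g(2) by simp
  then show "\<exists>h\<in>carrier (recurrence_group n f). h \<otimes>\<^bsub>recurrence_group n f\<^esub> g = \<one>\<^bsub>recurrence_group n f\<^esub>"
    using g \<open>n > 0\<close>
    by (intro bexI[of _ "((n - i) mod n, \<lambda>p. x (p + (n - i)))"])
      (auto simp: recurrence_group_def recurrent_mod[OF assms(1)] mod_simps)
qed (use assms in \<open>auto simp: recurrence_group_def recurrent_0\<close>)

text \<open>This brings the arcs into the shape used for \<open>PX\<close>: a directed relation
  together with its converse.\<close>

lemma (in group) Cay_arcs_closure:
  assumes "A \<subseteq> carrier G"
  shows "parcs (Cay G (A \<union> m_inv G ` A)) =
    (let E = {(g, s \<otimes> g) | g s. g \<in> carrier G \<and> s \<in> A} in E \<union> E\<inverse>)"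
proof -
  have 1: "h \<otimes> inv g \<in> A \<longleftrightarrow> (\<exists>s\<in>A. h = s \<otimes> g)" if "g \<in> carrier G" "h \<in> carrier G" for g h
    using that assms by (metis inv_solve_right subset_iff m_closed inv_closed)
  have 2: "h \<otimes> inv g \<in> m_inv G ` A \<longleftrightarrow> g \<otimes> inv h \<in> A" if "g \<in> carrier G" "h \<in> carrier G" for g h
  proof -
    have "inv (g \<otimes> inv h) = h \<otimes> inv g" using that by (simp add: inv_mult_group)
    then show ?thesis using that assms by (metis (no_types, lifting) image_iff inv_closed inv_inv m_closed subset_iff)
  qed
  have "(g, h) \<in> parcs (Cay G (A \<union> m_inv G ` A)) \<longleftrightarrow>
    g \<in> carrier G \<and> h \<in> carrier G \<and> ((\<exists>s\<in>A. h = s \<otimes> g) \<or> (\<exists>s\<in>A. g = s \<otimes> h))" for g h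
  proof (cases "g \<in> carrier G \<and> h \<in> carrier G")
    case True
    then have "h \<otimes> inv g \<in> A \<union> m_inv G ` A \<longleftrightarrow> (\<exists>s\<in>A. h = s \<otimes> g) \<or> (\<exists>s\<in>A. g = s \<otimes> h)"
      unfolding Un_iff by (simp only: 1 2)
    with True show ?thesis unfolding Cay_def by simp
  qed (auto simp: Cay_def)
  then show ?thesis
    using assms by (auto simp: Let_def)
qed

lemma cayley_PX_if_divisor:
  assumes "f dvd cyc n" "degree f = k" "n \<ge> 3" "k \<ge> 1"
  shows "cayley_graph (PX n k)"
proof -
  define G where "G = recurrence_group n f"
  interpret group G unfolding G_def by (rule group_recurrence_group) (use assms in auto)
  have "f \<noteq> 0" using assms by auto
  have carr: "carrier G = {..<n} \<times> recurrent f" and one: "\<one>\<^bsub>G\<^esub> = (0, \<lambda>_. 0)"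
    and mult: "(j, y) \<otimes>\<^bsub>G\<^esub> (i, x) = ((i + j) mod n, \<lambda>p. x (p + j) + y p)" for i j x y
    by (simp_all add: G_def recurrence_group_def)
  \<comment> \<open>Left multiplication by such an element shifts the window and can alter only its
    new last bit.\<close>
  define A where "A = {(1 :: nat, y) | y. y \<in> recurrent f \<and> (\<forall>j<k - 1. y j = 0)}"
  define S where "S = A \<union> m_inv G ` A"
  have A: "A \<subseteq> carrier G - {\<one>\<^bsub>G\<^esub>}" using assms by (auto simp: A_def carr one)
  then have A': "A \<subseteq> carrier G" by auto
  have S1: "S \<subseteq> carrier G - {\<one>\<^bsub>G\<^esub>}"
  proof
    fix g assume "g \<in> S"
    then obtain s where "s \<in> A" "g = s \<or> g = inv\<^bsub>G\<^esub> s" unfolding S_def by blast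
    moreover have "s \<in> carrier G" "s \<noteq> \<one>\<^bsub>G\<^esub>" using A \<open>s \<in> A\<close> by auto
    ultimately show "g \<in> carrier G - {\<one>\<^bsub>G\<^esub>}" using inv_eq_1_iff by auto
  qed
  have "m_inv G ` m_inv G ` A = A"
    unfolding image_image using A' by (force simp: subset_iff image_iff)
  then have S2: "S = m_inv G ` S" unfolding S_def image_Un by auto
  have window: "map x [1..<k + 1] = map (\<lambda>j. x (Suc j)) [0..<k]" for x :: "nat \<Rightarrow> bit"
    by (rule nth_equalityI) (simp_all del: upt_Suc)
  define F where "F = (\<lambda>(i :: nat, x :: nat \<Rightarrow> bit). (i, map x [0..<k]))"
  have rec: "recurrence f xs \<in> recurrent f" if "length xs = k" for xs
    by (rule recurrence_recurrent) (use that assms \<open>f \<noteq> 0\<close> in auto)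
  have "bij_betw F (pverts (Cay G S)) (pverts (PX n k))"
    unfolding bij_betw_def
  proof
    have "x = y" if "x \<in> recurrent f" "y \<in> recurrent f" "map x [0..<k] = map y [0..<k]" for x y
      by (rule recurrent_eqI[OF \<open>f \<noteq> 0\<close> assms(2) that(1,2)]) (use that(3) in auto)
    then show "inj_on F (pverts (Cay G S))"
      unfolding pverts_Cay carr by (auto simp: inj_on_def F_def simp del: map_eq_conv)
    show "F ` pverts (Cay G S) = pverts (PX n k)"
    proof (intro subset_antisym subsetI)
      fix v assume "v \<in> pverts (PX n k)"
      then obtain i xs where v: "v = (i, xs)" "i < n" "length xs = k" by (auto simp: PX_def)
      then have "v = F (i, recurrence f xs)"
        using map_recurrence[of f xs] by (simp add: F_def)
      then show "v \<in> F ` pverts (Cay G S)"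
        using rec v unfolding pverts_Cay carr by blast
    qed (auto simp: pverts_Cay carr F_def PX_def)
  qed
  moreover have "parcs (PX n k) = map_prod F F ` parcs (Cay G S)"
  proof -
    define E where "E = {(g, s \<otimes>\<^bsub>G\<^esub> g) | g s. g \<in> carrier G \<and> s \<in> A}"
    have "PX_step n k = map_prod F F ` E"
    proof (intro subset_antisym subsetI)
      fix e assume "e \<in> PX_step n k"
      then obtain i x where e: "i < n" "e = ((i, map x [0..<k]), ((i + 1) mod n, map x [1..<k + 1]))"
        by (auto simp: PX_step_def)
      \<comment> \<open>The solution \<open>x'\<close> agrees with \<open>x\<close> on the window
        but perhaps not at \<open>k\<close>. The solution \<open>y\<close> supplies the difference
        there, and its first \<open>k - 1\<close> terms vanish.\<close>
      define x' where "x' = recurrence f (map x [0..<k])"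
      define y where "y = recurrence f (map (\<lambda>j. x (j + 1) + x' (j + 1)) [0..<k])"
      have x': "x' \<in> recurrent f" "j < k \<Longrightarrow> x' j = x j" for j
        unfolding x'_def by (auto intro: rec simp: recurrence_nth)
      have y: "y \<in> recurrent f" "j < k \<Longrightarrow> y j = x (j + 1) + x' (j + 1)" for j
        unfolding y_def by (auto intro: rec simp: recurrence_nth)
      have "(1, y) \<in> A" using y x' by (auto simp: A_def)
      moreover have "(i, x') \<in> carrier G" using x' e by (simp add: carr)
      ultimately have "((i, x'), (1, y) \<otimes>\<^bsub>G\<^esub> (i, x')) \<in> E" unfolding E_def by blast
      moreover have "map_prod F F ((i, x'), (1, y) \<otimes>\<^bsub>G\<^esub> (i, x')) = e"
        unfolding e window mult by (auto simp: F_def x' y algebra_simps)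
      ultimately show "e \<in> map_prod F F ` E" by (metis imageI)
    next
      fix e assume "e \<in> map_prod F F ` E"
      then obtain i x y where e: "i < n" "\<forall>j<k - 1. y j = 0"
        "e = map_prod F F ((i, x), (1, y) \<otimes>\<^bsub>G\<^esub> (i, x))"
        by (auto simp: E_def A_def carr)
      \<comment> \<open>The bit entering the window sits at position \<open>k\<close> and absorbs
        the last term of \<open>y\<close>.\<close>
      define z where "z = x(k := x k + y (k - 1))"
      have "e = ((i, map z [0..<k]), ((i + 1) mod n, map z [1..<k + 1]))"
        unfolding e window mult using e(2) by (auto simp: F_def z_def)
      then show "e \<in> PX_step n k" using \<open>i < n\<close> by (auto simp: PX_step_def)
    qed
    moreover have "parcs (Cay G S) = E \<union> E\<inverse>"
      unfolding S_def Cay_arcs_closure[OF A'] by (simp add: E_def Let_def)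
    moreover have "map_prod F F ` (E\<inverse>) = (map_prod F F ` E)\<inverse>" by force
    ultimately show ?thesis by (simp add: PX_def image_Un)
  qed
  ultimately have "digraph_iso (with_proj (Cay G S)) (with_proj (PX n k))"
    unfolding digraph_iso_with_proj_iff[OF pair_wf_digraph_Cay] by blast
  then show ?thesis by (rule cayley_graphI[OF is_group S1 S2])
qed

lemma bit_add_self_left [simp]: "x + (x + y) = (y :: bit)"
  by (simp flip: add.assoc)

section \<open>Automorphisms\<close>

text \<open>For \<open>n = 4\<close> four forward steps can close up, and for \<open>k = 1\<close>
  consecutive words do not overlap; either would spoil the recognition of orientation from common
  neighbours.\<close>

locale praeger_xu =
  fixes n k :: nat
  assumes n3: "3 \<le> n" and n4: "n \<noteq> 4" and k2: "2 \<le> k"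
begin

definition V :: "(nat \<times> bit list) set" where
  "V = {..<n} \<times> {xs. length xs = k}"

definition step :: "nat \<times> bit list \<Rightarrow> nat \<times> bit list \<Rightarrow> bool" where
  "step u v \<longleftrightarrow> (u, v) \<in> PX_step n k"

definition adj :: "nat \<times> bit list \<Rightarrow> nat \<times> bit list \<Rightarrow> bool" where
  "adj u v \<longleftrightarrow> step u v \<or> step v u"

text \<open>A vertex is a window of length \<open>k\<close> of a bi-infinite sequence, and a step moves the window by one.\<close>

definition vt :: "int \<Rightarrow> (int \<Rightarrow> bit) \<Rightarrow> nat \<times> bit list" where
  "vt i x = (nat (i mod int n), map (\<lambda>j. x (i + int j)) [0..<k])"

lemma vt_in_V [simp]: "vt i x \<in> V"
  using n3 by (auto simp: vt_def V_def nat_less_iff)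

lemma fst_vt: "fst (vt i x) = nat (i mod int n)"
  by (simp add: vt_def)

lemma snd_vt_nth: "j < k \<Longrightarrow> snd (vt i x) ! j = x (i + int j)"
  by (simp add: vt_def)

lemma nat_mod_eq_iff: "nat (i mod int n) = nat (j mod int n) \<longleftrightarrow> [i = j] (mod int n)"
  using n3 by (simp add: cong_def eq_nat_nat_iff)

lemma vt_eq_iff: "vt i x = vt j y \<longleftrightarrow> [i = j] (mod int n) \<and> (\<forall>l<k. x (i + int l) = y (j + int l))"
  by (auto simp: vt_def nat_mod_eq_iff)

lemma V_obtain_at:
  assumes "v \<in> V"
  obtains x where "v = vt (int (fst v)) x"
proof
  show "v = vt (int (fst v)) (\<lambda>p. snd v ! nat (p - int (fst v)))"
    using assms by (auto simp: V_def vt_def map_nth)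
qed

lemma step_iff:
  "step u v \<longleftrightarrow> u \<in> V \<and> v \<in> V \<and> fst v = (fst u + 1) mod n \<and> (\<forall>j. Suc j < k \<longrightarrow> snd v ! j = snd u ! Suc j)"
proof
  assume "step u v"
  then show "u \<in> V \<and> v \<in> V \<and> fst v = (fst u + 1) mod n \<and> (\<forall>j. Suc j < k \<longrightarrow> snd v ! j = snd u ! Suc j)"
    using n3 by (auto simp: step_def PX_step_def V_def simp del: upt_Suc)
next
  assume *: "u \<in> V \<and> v \<in> V \<and> fst v = (fst u + 1) mod n \<and> (\<forall>j. Suc j < k \<longrightarrow> snd v ! j = snd u ! Suc j)"
  \<comment> \<open>The two windows cover positions 0 to \<open>k\<close>, and position
    \<open>k\<close> carries the last bit of \<open>v\<close>.\<close>
  define x where "x j = (if j < k then snd u ! j else snd v ! (k - 1))" for j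
  have "u = (fst u, map x [0..<k])"
    using * by (auto simp: V_def x_def intro!: nth_equalityI)
  moreover have "snd v = map x [1..<k + 1]"
  proof (rule nth_equalityI)
    fix j assume "j < length (snd v)"
    then have "j < k" using * by (auto simp: V_def)
    then show "snd v ! j = map x [1..<k + 1] ! j"
      using * by (cases "Suc j = k") (auto simp: x_def simp del: upt_Suc)
  qed (use * k2 in \<open>auto simp: V_def\<close>)
  then have "v = ((fst u + 1) mod n, map x [1..<k + 1])" using * by (metis prod.collapse)
  moreover have "fst u < n" using * by (auto simp: V_def)
  ultimately show "step u v" unfolding step_def PX_step_def by blast
qed

lemma step_in_V: "step u v \<Longrightarrow> u \<in> V \<and> v \<in> V"
  by (simp add: step_iff)

lemma step_vt: "step (vt i x) (vt (i + 1) x)"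
  using n3 by (auto simp: step_iff fst_vt snd_vt_nth nat_mod_as_int mod_simps algebra_simps)

lemma step_obtain:
  assumes "step u v"
  obtains i x where "u = vt i x" "v = vt (i + 1) x"
proof -
  define x where "x p = (let j = nat (p - int (fst u)) in if j < k then snd u ! j else snd v ! (k - 1))" for p
  have *: "u \<in> V" "v \<in> V" "fst v = (fst u + 1) mod n" "\<And>j. Suc j < k \<Longrightarrow> snd v ! j = snd u ! Suc j"
    using assms by (auto simp: step_iff)
  have "u = vt (int (fst u)) x"
  proof (rule prod_eqI)
    show "snd u = snd (vt (int (fst u)) x)"
      by (rule nth_equalityI) (use *(1) in \<open>auto simp: V_def vt_def x_def\<close>)
  qed (use *(1) in \<open>auto simp: V_def vt_def\<close>)
  moreover have "v = vt (int (fst u) + 1) x"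
  proof (rule prod_eqI)
    show "fst v = fst (vt (int (fst u) + 1) x)"
      using *(3) by (simp add: fst_vt nat_mod_as_int add.commute)
    show "snd v = snd (vt (int (fst u) + 1) x)"
    proof (rule nth_equalityI)
      fix j assume "j < length (snd v)"
      then have "j < k" using *(2) by (auto simp: V_def)
      have "nat (int (fst u) + 1 + int j - int (fst u)) = Suc j" by simp
      then have "x (int (fst u) + 1 + int j) = (if Suc j < k then snd u ! Suc j else snd v ! (k - 1))"
        by (simp only: x_def Let_def)
      with \<open>j < k\<close> show "snd v ! j = snd (vt (int (fst u) + 1) x) ! j"
        using *(4)[of j] by (cases "Suc j = k") (auto simp: snd_vt_nth)
    qed (use *(2) in \<open>auto simp: V_def vt_def\<close>)
  qed
  ultimately show ?thesis using that by blast
qed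

section \<open>Automorphisms preserve or reverse the orientation\<close>

definition nxt :: "nat \<Rightarrow> nat" where
  "nxt a = (if Suc a = n then 0 else Suc a)"

lemma fst_step: "step u v \<Longrightarrow> fst u < n \<and> fst v < n \<and> fst v = nxt (fst u)"
proof -
  assume "step u v"
  then have "fst u < n" "fst v < n" "fst v = Suc (fst u) mod n" by (auto simp: step_iff V_def)
  then show ?thesis by (simp add: mod_Suc nxt_def)
qed

lemma nxt_nxt: "nxt (nxt a) \<noteq> a"
  using n3 by (simp add: nxt_def)

lemma nxt_nxt_nxt_nxt: "a < n \<Longrightarrow> nxt (nxt (nxt (nxt a))) \<noteq> a"
  using n3 n4 by (simp add: nxt_def)

lemma nxt_inj: "nxt a = nxt b \<Longrightarrow> a = b"
  by (simp add: nxt_def split: if_splits)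

text \<open>Comparing fibre indices forces \<open>w\<close>, \<open>z\<close>, \<open>v\<close> to
  be consecutive, since any other direction gives 2 = 0 or 4 = 0 modulo \<open>n\<close>. Then
  \<open>w\<close> determines all bits of \<open>z\<close> but the last and \<open>v\<close> all but
  the first, which together is every bit because \<open>2 \<le> k\<close>.\<close>

lemma common_neighbour_opposite:
  assumes wu: "step w u" and uv: "step u v" and "adj z w" "adj z v"
  shows "z = u"
proof -
  have i: "fst v = nxt (nxt (fst w))" "fst w < n"
    using fst_step[OF wu] fst_step[OF uv] by auto
  have "\<not> (step z w \<and> step z v)"
    using fst_step i(1) nxt_nxt by metis
  moreover have "\<not> (step w z \<and> step v z)"
    using fst_step i(1) nxt_nxt nxt_inj by metis
  moreover have "\<not> (step z w \<and> step v z)"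
    using fst_step i nxt_nxt_nxt_nxt by metis
  ultimately have *: "step w z" "step z v" using assms(3,4) by (auto simp: adj_def)
  show "z = u"
  proof (rule prod_eqI)
    show "fst z = fst u" using fst_step[OF *(1)] fst_step[OF wu] by simp
    show "snd z = snd u"
    proof (rule nth_equalityI)
      show "length (snd z) = length (snd u)" using * uv by (auto simp: step_iff V_def)
      fix j assume "j < length (snd z)"
      then have "j < k" using * by (auto simp: step_iff V_def)
      show "snd z ! j = snd u ! j"
      proof (cases "Suc j < k")
        case True
        then have "snd z ! j = snd w ! Suc j" "snd u ! j = snd w ! Suc j"
          using * wu by (simp_all add: step_iff)
        then show ?thesis by simp
      next
        case False
        then obtain i where i: "j = Suc i" using \<open>j < k\<close> k2 by (cases j) auto
        then have "snd v ! i = snd z ! j" "snd v ! i = snd u ! j"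
          using * uv \<open>j < k\<close> by (simp_all add: step_iff)
        then show ?thesis by simp
      qed
    qed
  qed
qed

text \<open>A forward step drops the first bit, so flipping it keeps all out-neighbours.\<close>

lemma common_neighbour_out:
  assumes "step u v" "step u v'"
  obtains z where "z \<noteq> u" "adj z v" "adj z v'"
proof
  define z where "z = (fst u, (snd u)[0 := snd u ! 0 + 1])"
  have u: "u \<in> V" "length (snd u) = k" using assms by (simp_all add: step_iff V_def mem_Times_iff)
  have "snd z ! 0 = snd u ! 0 + 1" using u k2 by (simp add: z_def)
  then show "z \<noteq> u" by (cases "snd u ! 0") auto
  have z: "z \<in> V" "fst z = fst u" using u by (simp_all add: z_def V_def mem_Times_iff)
  have "snd z ! Suc j = snd u ! Suc j" if "Suc j < k" for j using that by (simp add: z_def)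
  with z show "adj z v" "adj z v'" using assms by (simp_all add: adj_def step_iff)
qed

text \<open>The last bit of \<open>u\<close> is free in a step into \<open>u\<close>, so flipping it
  keeps all in-neighbours.\<close>

lemma common_neighbour_in:
  assumes "step v u" "step v' u"
  obtains z where "z \<noteq> u" "adj z v" "adj z v'"
proof
  define z where "z = (fst u, (snd u)[(k - 1) := snd u ! (k - 1) + 1])"
  have u: "u \<in> V" "length (snd u) = k" using assms by (simp_all add: step_iff V_def mem_Times_iff)
  have "snd z ! (k - 1) = snd u ! (k - 1) + 1" using u k2 by (simp add: z_def)
  then show "z \<noteq> u" by (cases "snd u ! (k - 1)") auto
  have z: "z \<in> V" "fst z = fst u" using u by (simp_all add: z_def V_def mem_Times_iff)
  have "snd z ! j = snd u ! j" if "Suc j < k" for j using that by (simp add: z_def)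
  with z show "adj z v" "adj z v'" using assms by (simp_all add: adj_def step_iff)
qed

definition aut :: "(nat \<times> bit list \<Rightarrow> nat \<times> bit list) \<Rightarrow> bool" where
  "aut g \<longleftrightarrow> bij_betw g V V \<and> (\<forall>u\<in>V. \<forall>v\<in>V. adj (g u) (g v) \<longleftrightarrow> adj u v)"

lemma aut_in_V: "aut g \<Longrightarrow> v \<in> V \<Longrightarrow> g v \<in> V"
  by (auto simp: aut_def bij_betw_def)

lemma aut_inj: "aut g \<Longrightarrow> u \<in> V \<Longrightarrow> v \<in> V \<Longrightarrow> g u = g v \<Longrightarrow> u = v"
  by (auto simp: aut_def bij_betw_def inj_on_def)

lemma adj_in_V: "adj u v \<Longrightarrow> u \<in> V \<and> v \<in> V"
  by (auto simp: adj_def step_iff)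

lemma aut_adj: "aut g \<Longrightarrow> adj u v \<Longrightarrow> adj (g u) (g v)"
  using adj_in_V by (auto simp: aut_def)

text \<open>Otherwise \<open>g v'\<close> and \<open>g v\<close> lie on opposite sides of
  \<open>g u\<close> and have no other common neighbour, whereas \<open>v\<close> and
  \<open>v'\<close> have one besides \<open>u\<close>.\<close>

lemma aut_same_direction:
  assumes "aut g" "step u v" "step u v'" "step (g u) (g v)"
  shows "step (g u) (g v')"
proof (rule ccontr)
  assume "\<not> step (g u) (g v')"
  then have *: "step (g v') (g u)" using aut_adj[OF assms(1), of u v'] assms(3) by (auto simp: adj_def)
  obtain z where z: "z \<noteq> u" "adj z v" "adj z v'" using common_neighbour_out assms(2,3) by blast
  then have "g z = g u"
    using common_neighbour_opposite[OF * assms(4)] aut_adj[OF assms(1)] by blast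
  then show False
    using z(1) aut_inj[OF assms(1)] adj_in_V[OF z(2)] step_in_V[OF assms(2)] by blast
qed

text \<open>Otherwise \<open>g u\<close> and \<open>g w\<close> lie on the same side of
  \<open>g v\<close>; a second common neighbour pulls back to one of \<open>u\<close> and
  \<open>w\<close>, which lie on opposite sides of \<open>v\<close>.\<close>

lemma aut_next_direction:
  assumes "aut g" "step u v" "step v w" "step (g u) (g v)"
  shows "step (g v) (g w)"
proof (rule ccontr)
  assume "\<not> step (g v) (g w)"
  then have *: "step (g w) (g v)" using aut_adj[OF assms(1), of v w] assms(3) by (auto simp: adj_def)
  obtain z' where z': "z' \<noteq> g v" "adj z' (g u)" "adj z' (g w)"
    using common_neighbour_in[OF assms(4) *] by blast
  have V: "u \<in> V" "w \<in> V" using step_in_V assms by blast+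
  have "z' \<in> g ` V" using adj_in_V[OF z'(2)] assms(1) by (simp add: aut_def bij_betw_def)
  then obtain z where z: "z \<in> V" "z' = g z" by blast
  then have "adj z u" "adj z w" using z' V assms(1) by (auto simp: aut_def)
  then have "z = v" using common_neighbour_opposite[OF assms(2,3)] by blast
  with z z' show False by simp
qed

definition directed :: "(nat \<times> bit list \<Rightarrow> nat \<times> bit list) \<Rightarrow> bool" where
  "directed g \<longleftrightarrow> (\<forall>u v. step u v \<longrightarrow> step (g u) (g v))"

text \<open>Orientation propagates along a sequence, and a sequence through the given window can be
  continued to reach any other vertex.\<close>

lemma directedI:
  assumes "aut g" "step (g (vt i x)) (g (vt (i + 1) x))"
  shows "directed g"
  unfolding directed_def
proof (intro allI impI)
  define P where "P u \<longleftrightarrow> (\<forall>v. step u v \<longrightarrow> step (g u) (g v))" for u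
  have P_next: "P (vt (i + int m) z)" if "P (vt i z)" for i z m
  proof (induction m)
    case (Suc m)
    have s: "step (vt (i + int m) z) (vt (i + int m + 1) z)" by (rule step_vt)
    with Suc have "step (g (vt (i + int m) z)) (g (vt (i + int m + 1) z))"
      unfolding P_def by blast
    with aut_next_direction[OF assms(1) s] have "P (vt (i + int m + 1) z)"
      unfolding P_def by blast
    then show ?case by (simp add: algebra_simps)
  qed (simp add: that)
  fix u v assume uv: "step u v"
  then obtain j y where u: "u = vt j y" by (metis step_obtain)
  define M where "M = nat (\<bar>i\<bar> + \<bar>j\<bar> + int k)"
  have "int M * 1 \<le> int M * int n" using n3 by (intro mult_left_mono) auto
  then have M: "j + int n * int M \<ge> i + int k" by (simp add: M_def algebra_simps)
  \<comment> \<open>The target window is moved by \<open>M\<close> full turns, far enough to be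
    disjoint from the starting window; \<open>z\<close> joins the two.\<close>
  define z where "z p = (if p < i + int k then x p else y (p - int n * int M))" for p
  have "vt i z = vt i x" by (simp add: vt_eq_iff z_def)
  moreover have "P (vt i x)"
    using aut_same_direction[OF assms(1) step_vt _ assms(2)] unfolding P_def by blast
  ultimately have "P (vt i z)" by simp
  moreover have "i + int (nat (j + int n * int M - i)) = j + int n * int M" using M by simp
  ultimately have "P (vt (j + int n * int M) z)" using P_next by metis
  moreover have "vt (j + int n * int M) z = vt j y"
    using M by (auto simp: vt_eq_iff z_def cong_def algebra_simps)
  ultimately show "step (g u) (g v)" using uv u unfolding P_def by metis
qed

definition rv :: "nat \<times> bit list \<Rightarrow> nat \<times> bit list" where
  "rv v = (nat ((- int (fst v)) mod int n), rev (snd v))"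

text \<open>The reversal is about \<open>k - 1\<close> and not 0 because \<open>i\<close> marks the
  left end of the window.\<close>

lemma rv_vt: "rv (vt i x) = vt (- i) (\<lambda>p. x (int k - 1 - p))"
proof (rule prod_eqI)
  show "fst (rv (vt i x)) = fst (vt (- i) (\<lambda>p. x (int k - 1 - p)))"
    using n3 by (simp add: rv_def fst_vt mod_minus_eq)
  show "snd (rv (vt i x)) = snd (vt (- i) (\<lambda>p. x (int k - 1 - p)))"
    by (rule nth_equalityI) (auto simp: rv_def vt_def rev_nth of_nat_diff algebra_simps)
qed

lemma rv_in_V: "v \<in> V \<Longrightarrow> rv v \<in> V"
  using V_obtain_at[of v] by (metis rv_vt vt_in_V)

lemma rv_rv: "v \<in> V \<Longrightarrow> rv (rv v) = v"
  using V_obtain_at[of v] by (metis (no_types, lifting) rv_vt add.inverse_inverse diff_diff_eq2 add_diff_cancel_left' vt_eq_iff cong_refl)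

lemma rv_step: "step u v \<Longrightarrow> step (rv v) (rv u)"
proof -
  assume "step u v"
  then obtain i x where "u = vt i x" "v = vt (i + 1) x" by (metis step_obtain)
  then show ?thesis using step_vt[of "- (i + 1)"] by (simp add: rv_vt)
qed

lemma aut_rv_comp:
  assumes "aut g"
  shows "aut (rv \<circ> g)"
proof -
  have "bij_betw rv V V" by (rule bij_betwI[of _ _ _ rv]) (auto simp: rv_rv rv_in_V)
  moreover have "step (rv u) (rv v) \<longleftrightarrow> step v u" if "u \<in> V" "v \<in> V" for u v
    using rv_step rv_rv that by metis
  then have "adj (rv u) (rv v) \<longleftrightarrow> adj u v" if "u \<in> V" "v \<in> V" for u v
    using that by (auto simp: adj_def)
  ultimately show ?thesis
    using assms aut_in_V[OF assms] by (auto simp: aut_def intro: bij_betw_trans)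
qed

lemma aut_directed:
  assumes "aut g"
  shows "directed g \<or> directed (rv \<circ> g)"
proof -
  have "adj (g (vt 0 0)) (g (vt (0 + 1) 0))"
    using aut_adj[OF assms] step_vt[of 0 0] unfolding adj_def by blast
  then consider "step (g (vt 0 0)) (g (vt (0 + 1) 0))" | "step (g (vt (0 + 1) 0)) (g (vt 0 0))"
    unfolding adj_def by blast
  then show ?thesis
  proof cases
    case 1
    then show ?thesis using directedI[OF assms] by blast
  next
    case 2
    then have "step ((rv \<circ> g) (vt 0 0)) ((rv \<circ> g) (vt (0 + 1) 0))" by (simp add: rv_step)
    then show ?thesis using directedI[OF aut_rv_comp[OF assms]] by blast
  qed
qed

end

section \<open>Orientation-preserving automorphisms as rotations composed with flips\<close>

context praeger_xu
begin

text \<open>\<open>g\<close> flips the vertex by \<open>c\<close> and then rotates it by \<open>s\<close>.\<close>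

definition acts :: "(nat \<times> bit list \<Rightarrow> nat \<times> bit list) \<Rightarrow> int \<Rightarrow> (int \<Rightarrow> bit) \<Rightarrow> bool" where
  "acts g s c \<longleftrightarrow> (\<forall>i x. g (vt i x) = vt (i + s) (\<lambda>p. x (p - s) + c (p - s)))"

lemma fst_eq_cong: "fst (vt i x) = fst (vt j y) \<longleftrightarrow> [i = j] (mod int n)"
  by (simp add: fst_vt nat_mod_eq_iff)

lemma vt_eqI:
  assumes "v \<in> V" "fst v = fst (vt i x)" "\<And>j. j < k \<Longrightarrow> snd v ! j = x (i + int j)"
  shows "v = vt i x"
proof (rule prod_eqI[OF assms(2)], rule nth_equalityI)
  show "length (snd v) = length (snd (vt i x))" using assms(1) by (simp add: V_def mem_Times_iff vt_def)
  then show "snd v ! j = snd (vt i x) ! j" if "j < length (snd v)" for j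
    using that assms(3)[of j] by (simp add: vt_def)
qed

lemma acts_step_index:
  assumes "directed g"
  shows "[int (fst (g (vt (i + 1) x))) = int (fst (g (vt i x))) + 1] (mod int n)"
proof -
  have "step (g (vt i x)) (g (vt (i + 1) x))" using assms step_vt unfolding directed_def by blast
  then have "fst (g (vt (i + 1) x)) = (fst (g (vt i x)) + 1) mod n" by (simp add: step_iff)
  then have "int (fst (g (vt (i + 1) x))) = (int (fst (g (vt i x))) + 1) mod int n"
    by (simp add: zmod_int add.commute)
  then show ?thesis by (simp add: cong_def)
qed

text \<open>Along one sequence the displacement of the fibre is constant, since both indices grow by
  one. Two sequences are linked by a third that agrees with the first on the window at 0 and with
  the second on the window at \<open>k\<close>.\<close>

lemma directed_index:
  assumes "directed g"
  shows "[int (fst (g (vt i x))) - i = int (fst (g (vt j y))) - j] (mod int n)"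
proof -
  define e where "e i x = int (fst (g (vt i x))) - i" for i x
  have step: "[e (i + int m) x = e i x] (mod int n)" for i m x
  proof (induction m)
    case (Suc m)
    have "[int (fst (g (vt (i + int m + 1) x))) - (i + int m + 1) =
        int (fst (g (vt (i + int m) x))) + 1 - (i + int m + 1)] (mod int n)"
      by (rule cong_diff[OF acts_step_index[OF assms] cong_refl])
    also have "int (fst (g (vt (i + int m) x))) + 1 - (i + int m + 1) = e (i + int m) x"
      by (simp add: e_def)
    also note Suc
    finally show ?case by (simp add: e_def algebra_simps)
  qed simp
  have same: "[e i x = e j x] (mod int n)" for i j x
  proof (cases "i \<le> j")
    case True
    then show ?thesis using step[of i "nat (j - i)" x] by (simp add: cong_sym)
  next
    case False
    then show ?thesis using step[of j "nat (i - j)" x] by simp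
  qed
  define z where "z p = (if p < int k then x p else y p)" for p
  have "vt 0 x = vt 0 z" "vt (int k) z = vt (int k) y" by (simp_all add: vt_eq_iff z_def)
  then have "e 0 x = e 0 z" "e (int k) z = e (int k) y" by (simp_all add: e_def)
  then have "[e i x = e j y] (mod int n)"
    using same[of i x 0] same[of 0 z "int k"] same[of "int k" y j] by (metis cong_trans)
  then show ?thesis by (simp add: e_def)
qed

lemma vt_const_period: "vt (i + int n) (\<lambda>_. a) = vt i (\<lambda>_. a)"
  by (simp add: vt_eq_iff cong_def)

text \<open>The bit of \<open>g (vt i x)\<close> in position \<open>j\<close> is also the first bit of \<open>g (vt (i + j) x)\<close> and the
  last bit of \<open>g (vt (i + j - k + 1) x)\<close>; the two windows meet only in position \<open>i + j\<close>.\<close>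

lemma directed_bits:
  assumes "directed g"
  obtains h where "\<And>i x j. j < k \<Longrightarrow> snd (g (vt i x)) ! j = h (i + int j) (x (i + int j))"
    and "\<And>p a. h (p + int n) a = h p a"
proof
  define b where "b i x j = snd (g (vt i x)) ! j" for i x j
  have b_step: "b (i + 1) x j = b i x (Suc j)" if "Suc j < k" for i x j
  proof -
    have "step (g (vt i x)) (g (vt (i + 1) x))" using assms step_vt unfolding directed_def by blast
    then show ?thesis using that by (simp add: step_iff b_def)
  qed
  have b_eq: "b i x j = b (i + int j) x 0" if "j < k" for i x j
    using that
  proof (induction j arbitrary: i)
    case (Suc j)
    have "b i x (Suc j) = b (i + 1) x j" by (rule b_step[OF Suc.prems, symmetric])
    also have "\<dots> = b (i + 1 + int j) x 0" using Suc.IH[of "i + 1"] Suc.prems by simp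
    finally show ?case by (simp add: algebra_simps)
  qed simp
  have cong: "b p x 0 = b p y 0" if "x p = y p" for p x y
  proof -
    define z where "z q = (if q \<le> p then x q else y q)" for q
    have last: "b p w 0 = b (p - int (k - 1)) w (k - 1)" for w
      using b_eq[of "k - 1" "p - int (k - 1)" w] k2 by simp
    have "vt (p - int (k - 1)) x = vt (p - int (k - 1)) z" by (auto simp: vt_eq_iff z_def)
    then have "b p x 0 = b p z 0" unfolding last by (simp add: b_def)
    moreover have "vt p z = vt p y" using that by (auto simp: vt_eq_iff z_def)
    then have "b p z 0 = b p y 0" by (simp add: b_def)
    ultimately show ?thesis by simp
  qed
  \<comment> \<open>By \<open>cong\<close> only the bit at \<open>p\<close> matters, so a constant
    sequence can represent it.\<close>
  define h where "h p a = b p (\<lambda>_. a) 0" for p a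
  show "snd (g (vt i x)) ! j = h (i + int j) (x (i + int j))" if "j < k" for i x j
    using b_eq[OF that, of i x] cong[of x "i + int j" "\<lambda>_. x (i + int j)"] by (simp add: b_def h_def)
  show "h (p + int n) a = h p a" for p a
    by (simp add: h_def b_def vt_const_period)
qed

text \<open>Injectivity of \<open>g\<close> makes each map \<open>h p\<close> a permutation of the
  two bits, that is, the addition of \<open>h p 0\<close>.\<close>

lemma directed_acts:
  assumes "directed g" "bij_betw g V V"
  shows "\<exists>s c. periodic n c \<and> acts g s c"
proof -
  obtain h where h: "\<And>i x j. j < k \<Longrightarrow> snd (g (vt i x)) ! j = h (i + int j) (x (i + int j))"
    and per: "\<And>p a. h (p + int n) a = h p a"
    using directed_bits[OF assms(1)] by blast
  define s where "s = int (fst (g (vt 0 0)))"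
  have gV: "g (vt i x) \<in> V" for i x using assms(2) by (auto simp: bij_betw_def)
  have fst: "fst (g (vt i x)) = fst (vt (i + s) y)" for i x y
  proof -
    have "[int (fst (g (vt i x))) - i + i = s - 0 + i] (mod int n)"
      unfolding s_def by (intro cong_add directed_index[OF assms(1)] cong_refl)
    then have "[int (fst (g (vt i x))) = i + s] (mod int n)" by (simp add: add.commute)
    moreover obtain w where "g (vt i x) = vt (int (fst (g (vt i x)))) w" using V_obtain_at[OF gV] .
    ultimately show ?thesis by (metis fst_eq_cong)
  qed
  have ne: "h p 0 \<noteq> h p 1" for p
  proof
    assume eq: "h p 0 = h p 1"
    \<comment> \<open>If \<open>h p\<close> were constant, \<open>g\<close> could not distinguish
      the zero sequence from the one with a single 1 at \<open>p\<close>.\<close>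
    define y where "y = (\<lambda>q. if q = p then 1 else 0 :: bit)"
    have "g (vt p 0) = g (vt p y)"
    proof (rule prod_eqI)
      show "fst (g (vt p 0)) = fst (g (vt p y))" using fst by metis
      show "snd (g (vt p 0)) = snd (g (vt p y))"
      proof (rule nth_equalityI)
        have len: "length (snd (g (vt p x))) = k" for x using gV[of p x] by (simp add: V_def mem_Times_iff)
        then show "length (snd (g (vt p 0))) = length (snd (g (vt p y)))" by simp
        show "snd (g (vt p 0)) ! j = snd (g (vt p y)) ! j" if "j < length (snd (g (vt p 0)))" for j
          using that eq by (auto simp: len h y_def)
      qed
    qed
    then have "vt p 0 = vt p y" using assms(2) by (auto simp: bij_betw_def inj_on_def)
    then have "(0 :: int \<Rightarrow> bit) (p + int 0) = y (p + int 0)" unfolding vt_eq_iff using k2 by (metis less_le_trans zero_less_numeral)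
    then show False by (simp add: y_def)
  qed
  define c where "c p = h p 0" for p
  have h_eq: "h p a = a + c p" for p a
    using ne[of p] by (cases a; cases "h p 0"; cases "h p 1") (auto simp: c_def)
  have "acts g s c"
    unfolding acts_def
  proof (intro allI vt_eqI[OF gV] fst)
    show "snd (g (vt i x)) ! j = x (i + s + int j - s) + c (i + s + int j - s)" if "j < k" for i x j
      using that by (simp add: h h_eq algebra_simps)
  qed
  moreover have "periodic n c" by (simp add: periodic_def c_def per)
  ultimately show ?thesis by blast
qed

lemma aut_acts:
  assumes "aut g"
  shows "(\<exists>s c. periodic n c \<and> acts g s c) \<or> (\<exists>s c. periodic n c \<and> acts (rv \<circ> g) s c)"
  using aut_directed[OF assms] directed_acts aut_rv_comp[OF assms] assms unfolding aut_def by blast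

lemma acts_apply: "acts g s c \<Longrightarrow> g (vt i x) = vt (i + s) (\<lambda>p. x (p - s) + c (p - s))"
  by (simp add: acts_def)

lemma acts_id: "acts id 0 0"
  by (simp add: acts_def)

lemma acts_comp:
  assumes "acts g s c" "acts h t d"
  shows "acts (g \<circ> h) (s + t) (\<lambda>p. d p + c (p + t))"
  unfolding acts_def
proof (intro allI)
  fix i x
  show "(g \<circ> h) (vt i x) = vt (i + (s + t)) (\<lambda>p. x (p - (s + t)) + (d (p - (s + t)) + c (p - (s + t) + t)))"
    by (simp add: acts_apply[OF assms(1)] acts_apply[OF assms(2)] vt_eq_iff algebra_simps)
qed

lemma acts_unique:
  assumes "acts g s c" "acts g s d"
  shows "c = d"
proof
  fix p
  have "vt (p + s) (\<lambda>q. 0 + c (q - s)) = vt (p + s) (\<lambda>q. 0 + d (q - s))"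
    using acts_apply[OF assms(1), of p "\<lambda>_. 0"] acts_apply[OF assms(2), of p "\<lambda>_. 0"] by simp
  then have "\<forall>l<k. c (p + s + int l - s) = d (p + s + int l - s)" by (simp add: vt_eq_iff)
  then show "c p = d p" using k2 by (metis add_0_right add_diff_cancel_right' less_le_trans of_nat_0 zero_less_numeral)
qed

lemma acts_cong:
  assumes "acts g s c" "[s = t] (mod int n)"
  shows "acts g t c"
  unfolding acts_def
proof (intro allI)
  fix i x
  have "[i + s = i + t] (mod int n)" using assms(2) by (simp add: cong_add_lcancel)
  then show "g (vt i x) = vt (i + t) (\<lambda>p. x (p - t) + c (p - t))"
    by (simp add: acts_apply[OF assms(1)] vt_eq_iff algebra_simps)
qed

lemma acts_inv:
  assumes "acts g s c" "\<And>v. v \<in> V \<Longrightarrow> g' (g v) = v"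
  shows "acts g' (- s) (\<lambda>p. c (p - s))"
  unfolding acts_def
proof (intro allI)
  fix i x
  define y where "y = (\<lambda>p. x (p + s) + c p)"
  have "g (vt (i - s) y) = vt i x"
    by (simp add: acts_apply[OF assms(1)] vt_eq_iff y_def algebra_simps)
  then have "g' (vt i x) = vt (i - s) y" using assms(2) vt_in_V by metis
  then show "g' (vt i x) = vt (i + - s) (\<lambda>p. x (p - - s) + c (p - - s - s))"
    by (simp add: y_def)
qed

lemma acts_conj_rv:
  assumes "acts g s c"
  shows "acts (rv \<circ> g \<circ> rv) (- s) (\<lambda>p. c (int k - 1 - p))"
  unfolding acts_def
proof (intro allI)
  fix i x
  show "(rv \<circ> g \<circ> rv) (vt i x) = vt (i + - s) (\<lambda>p. x (p - - s) + c (int k - 1 - (p - - s)))"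
    by (simp add: rv_vt acts_apply[OF assms] vt_eq_iff algebra_simps)
qed

text \<open>On vertices \<open>g \<circ> h\<close> is the conjugate of \<open>rv \<circ> g\<close>
  by \<open>rv\<close>, composed with \<open>rv \<circ> h\<close>; conjugation negates the rotation
  and reverses the flip.\<close>

lemma acts_rv_rv:
  assumes "acts (rv \<circ> g) s c" "acts (rv \<circ> h) t d" "\<And>v. v \<in> V \<Longrightarrow> g v \<in> V" "\<And>v. v \<in> V \<Longrightarrow> h v \<in> V"
  shows "acts (g \<circ> h) (- s + t) (\<lambda>p. d p + c (int k - 1 - (p + t)))"
proof -
  have "(rv \<circ> (rv \<circ> g) \<circ> rv \<circ> (rv \<circ> h)) v = (g \<circ> h) v" if "v \<in> V" for v
    using that assms(3,4) by (simp add: rv_rv)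
  then have "(rv \<circ> (rv \<circ> g) \<circ> rv \<circ> (rv \<circ> h)) (vt i x) = (g \<circ> h) (vt i x)" for i x by simp
  then show ?thesis
    using acts_comp[OF acts_conj_rv[OF assms(1)] assms(2)] by (simp add: acts_def)
qed

lemma acts_rv_left:
  assumes "acts (rv \<circ> g) s c" "acts h t d"
  shows "acts (rv \<circ> (g \<circ> h)) (s + t) (\<lambda>p. d p + c (p + t))"
  using acts_comp[OF assms] by (simp only: comp_assoc)

lemma acts_rv_index:
  assumes "acts (rv \<circ> g) s c" "g (vt i x) \<in> V"
  shows "fst (g (vt i x)) = fst (vt (- (i + s)) y)"
proof -
  have "rv (g (vt i x)) = vt (i + s) (\<lambda>p. x (p - s) + c (p - s))"
    using acts_apply[OF assms(1), of i x] by simp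
  then have "g (vt i x) = rv (vt (i + s) (\<lambda>p. x (p - s) + c (p - s)))"
    using rv_rv[OF assms(2)] by simp
  then show ?thesis by (simp add: rv_vt fst_vt)
qed

text \<open>The fibre index cannot both increase and decrease: comparing fibres 0 and 1 would give 1
  = -1 modulo \<open>n\<close>.\<close>

lemma acts_not_rv:
  assumes "acts g s c" "acts (rv \<circ> g) t d"
  shows False
proof -
  have V: "g (vt i x) \<in> V" for i x using assms(1) by (simp add: acts_def)
  have "[i + s = - (i + t)] (mod int n)" for i
    using acts_rv_index[OF assms(2) V, of i 0 0] acts_apply[OF assms(1), of i 0]
    by (metis fst_eq_cong)
  from cong_diff[OF this[of 1] this[of 0]] have "[1 = - 1] (mod int n)" by simp
  then have "int n dvd 2" by (simp add: cong_iff_dvd_diff)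
  then have "int n \<le> 2" by (rule zdvd_imp_le) simp
  with n3 show False by simp
qed

end

section \<open>Regular groups of automorphisms\<close>

definition regular_automorphisms :: "('v \<Rightarrow> 'v) set \<Rightarrow> 'v pair_pre_digraph \<Rightarrow> bool" where
  "regular_automorphisms A \<Gamma> \<longleftrightarrow>
    (\<forall>g\<in>A. bij_betw g (pverts \<Gamma>) (pverts \<Gamma>) \<and>
      (\<forall>u\<in>pverts \<Gamma>. \<forall>v\<in>pverts \<Gamma>. (g u, g v) \<in> parcs \<Gamma> \<longleftrightarrow> (u, v) \<in> parcs \<Gamma>)) \<and>
    id \<in> A \<and> (\<forall>g\<in>A. \<forall>h\<in>A. g \<circ> h \<in> A) \<and> (\<forall>g\<in>A. \<exists>h\<in>A. h \<circ> g = id) \<and>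
    (\<forall>u\<in>pverts \<Gamma>. \<forall>v\<in>pverts \<Gamma>. \<exists>g\<in>A. g u = v) \<and>
    (\<forall>u\<in>pverts \<Gamma>. \<forall>g\<in>A. \<forall>h\<in>A. g u = h u \<longrightarrow> g = h)"

lemma cayley_graph_regular:
  assumes "cayley_graph \<Gamma>"
  shows "\<exists>A. regular_automorphisms A \<Gamma>"
proof -
  obtain G :: "'a monoid" and S where "group G"
    and iso: "digraph_iso (with_proj (Cay G S)) (with_proj \<Gamma>)"
    using assms unfolding cayley_graph_def by blast
  interpret group G by fact
  obtain f where bij: "bij_betw f (carrier G) (pverts \<Gamma>)"
    and arcs: "parcs \<Gamma> = map_prod f f ` parcs (Cay G S)"
    using iso[unfolded digraph_iso_with_proj_iff[OF pair_wf_digraph_Cay]]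
    unfolding pverts_Cay by blast
  define f' where "f' = the_inv_into (carrier G) f"
  have inj: "inj_on f (carrier G)" and img: "f ` carrier G = pverts \<Gamma>"
    using bij by (auto simp: bij_betw_def)
  have f'f [simp]: "f' (f x) = x" if "x \<in> carrier G" for x
    using that inj by (simp add: f'_def the_inv_into_f_f)
  have fV [simp]: "f x \<in> pverts \<Gamma>" if "x \<in> carrier G" for x using that img by blast
  \<comment> \<open>Arcs depend on \<open>y\<close> times the inverse of \<open>x\<close>, so right
    multiplications preserve them. Fixing everything outside the graph makes the group laws hold
    between total functions.\<close>
  define L where "L h v = (if v \<in> pverts \<Gamma> then f (f' v \<otimes>\<^bsub>G\<^esub> h) else v)" for h v
  have L: "L h (f x) = f (x \<otimes>\<^bsub>G\<^esub> h)" if "x \<in> carrier G" for h x using that by (simp add: L_def)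
  have L_comp: "L h \<circ> L h' = L (h' \<otimes>\<^bsub>G\<^esub> h)" if "h \<in> carrier G" "h' \<in> carrier G" for h h'
  proof
    fix v show "(L h \<circ> L h') v = L (h' \<otimes>\<^bsub>G\<^esub> h) v"
    proof (cases "v \<in> pverts \<Gamma>")
      case True
      then obtain x where "x \<in> carrier G" "v = f x" using img by blast
      then show ?thesis using that by (simp add: L m_assoc)
    qed (simp add: L_def)
  qed
  have L_one: "L \<one>\<^bsub>G\<^esub> = id"
  proof
    fix v show "L \<one>\<^bsub>G\<^esub> v = id v"
    proof (cases "v \<in> pverts \<Gamma>")
      case True
      then obtain x where "x \<in> carrier G" "v = f x" using img by blast
      then show ?thesis by (simp add: L)
    qed (simp add: L_def)
  qed
  have arc_iff: "(f x, f y) \<in> parcs \<Gamma> \<longleftrightarrow> y \<otimes>\<^bsub>G\<^esub> inv\<^bsub>G\<^esub> x \<in> S" if "x \<in> carrier G" "y \<in> carrier G" for x y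
    using that inj by (auto simp: arcs Cay_def inj_on_def image_iff)
  have ball: "(\<forall>g\<in>L ` carrier G. P g) \<longleftrightarrow> (\<forall>h\<in>carrier G. P (L h))"
    and bex: "(\<exists>g\<in>L ` carrier G. P g) \<longleftrightarrow> (\<exists>h\<in>carrier G. P (L h))" for P by blast+
  have "regular_automorphisms (L ` carrier G) \<Gamma>"
    unfolding regular_automorphisms_def ball bex
  proof (intro conjI ballI allI impI)
    fix h assume h: "h \<in> carrier G"
    show "bij_betw (L h) (pverts \<Gamma>) (pverts \<Gamma>)"
    proof (rule bij_betwI[where g = "L (inv\<^bsub>G\<^esub> h)"])
      show "L h \<in> pverts \<Gamma> \<rightarrow> pverts \<Gamma>" "L (inv\<^bsub>G\<^esub> h) \<in> pverts \<Gamma> \<rightarrow> pverts \<Gamma>"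
        using h by (auto simp: L simp flip: img)
      show "L (inv\<^bsub>G\<^esub> h) (L h v) = v" "L h (L (inv\<^bsub>G\<^esub> h) v) = v" for v
        using h L_comp[of "inv\<^bsub>G\<^esub> h" h] L_comp[of h "inv\<^bsub>G\<^esub> h"] L_one by (simp_all add: fun_eq_iff)
    qed
    fix u v assume "u \<in> pverts \<Gamma>" "v \<in> pverts \<Gamma>"
    then obtain x y where xy: "x \<in> carrier G" "u = f x" "y \<in> carrier G" "v = f y" using img by blast
    have "y \<otimes>\<^bsub>G\<^esub> h \<otimes>\<^bsub>G\<^esub> inv\<^bsub>G\<^esub> (x \<otimes>\<^bsub>G\<^esub> h) = y \<otimes>\<^bsub>G\<^esub> (h \<otimes>\<^bsub>G\<^esub> inv\<^bsub>G\<^esub> h) \<otimes>\<^bsub>G\<^esub> inv\<^bsub>G\<^esub> x"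
      using xy h by (simp only: inv_mult_group m_assoc m_closed inv_closed)
    then have "y \<otimes>\<^bsub>G\<^esub> h \<otimes>\<^bsub>G\<^esub> inv\<^bsub>G\<^esub> (x \<otimes>\<^bsub>G\<^esub> h) = y \<otimes>\<^bsub>G\<^esub> inv\<^bsub>G\<^esub> x" using xy h by simp
    then show "(L h u, L h v) \<in> parcs \<Gamma> \<longleftrightarrow> (u, v) \<in> parcs \<Gamma>"
      using xy h by (simp add: L arc_iff)
  next
    show "id \<in> L ` carrier G" using L_one by (metis imageI one_closed)
  next
    fix h h' assume "h \<in> carrier G" "h' \<in> carrier G"
    then show "L h \<circ> L h' \<in> L ` carrier G" by (simp add: L_comp)
  next
    fix h assume "h \<in> carrier G"
    then show "\<exists>h'\<in>carrier G. L h' \<circ> L h = id"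
      using L_comp[of "inv\<^bsub>G\<^esub> h" h] L_one by (intro bexI[of _ "inv\<^bsub>G\<^esub> h"]) simp_all
  next
    fix u v assume "u \<in> pverts \<Gamma>" "v \<in> pverts \<Gamma>"
    then obtain x y where xy: "x \<in> carrier G" "u = f x" "y \<in> carrier G" "v = f y" using img by blast
    then show "\<exists>h\<in>carrier G. L h u = v"
      by (intro bexI[of _ "inv\<^bsub>G\<^esub> x \<otimes>\<^bsub>G\<^esub> y"]) (simp_all add: L flip: m_assoc)
  next
    fix u h h' assume "u \<in> pverts \<Gamma>" and h: "h \<in> carrier G" "h' \<in> carrier G" "L h u = L h' u"
    then obtain x where x: "x \<in> carrier G" "u = f x" using img by blast
    then have "x \<otimes>\<^bsub>G\<^esub> h = x \<otimes>\<^bsub>G\<^esub> h'" using h inj by (simp add: L inj_on_eq_iff)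
    then show "L h = L h'" using x h by simp
  qed
  then show ?thesis by blast
qed

section \<open>Weights and preimages of codes under 1 + shift\<close>

lemma periodic_add: "periodic n x \<Longrightarrow> periodic n y \<Longrightarrow> periodic n (\<lambda>i. x i + y i)"
  by (simp add: periodic_def)

lemma periodic_shift: "periodic n x \<Longrightarrow> periodic n (\<lambda>i. x (i + s))"
  unfolding periodic_def by (metis add.assoc add.commute)

lemma periodic_reflect: "periodic n x \<Longrightarrow> periodic n (\<lambda>i. x (s - i))"
  unfolding periodic_def by (metis diff_add_cancel diff_diff_eq)

text \<open>The parity of the number of ones in a period, as the sum is taken in
  \<open>bit\<close>.\<close>

definition weight :: "nat \<Rightarrow> (int \<Rightarrow> bit) \<Rightarrow> bit" where
  "weight n x = (\<Sum>i<n. x (int i))"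

lemma weight_add: "weight n (\<lambda>i. x i + y i) = weight n x + weight n y"
  by (simp add: weight_def sum.distrib)

lemma weight_shift:
  assumes "periodic n x" "n > 0"
  shows "weight n (\<lambda>i. x (i + 1)) = weight n x"
proof -
  have "(\<Sum>i<Suc n. x (int i)) = x 0 + weight n (\<lambda>i. x (i + 1))"
    by (simp add: sum.lessThan_Suc_shift weight_def add.commute del: sum.lessThan_Suc)
  moreover have "(\<Sum>i<Suc n. x (int i)) = weight n x + x (int n)"
    by (simp add: weight_def)
  moreover have "x (int n) = x 0" using assms(1) by (metis add_0 periodic_def)
  ultimately show ?thesis by (metis add.commute add_left_cancel)
qed

text \<open>The partial sums of \<open>c\<close> solve the equation, and even weight makes them
  close up after \<open>n\<close> steps.\<close>

lemma weight_eq_0_obtain: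
  assumes "periodic n c" "weight n c = 0" "n > 0"
  obtains u where "periodic n u" "\<And>p. u p + u (p + 1) = c p"
proof
  define u where "u p = (\<Sum>j<nat (p mod int n). c (int j))" for p
  show "periodic n u" by (simp add: periodic_def u_def)
  fix p
  define m where "m = nat (p mod int n)"
  have m: "int m = p mod int n" "m < n" using assms(3) by (auto simp: m_def nat_less_iff)
  then have "c p = c (int m)"
    by (intro periodic_cong[OF assms(1)]) (simp add: cong_def)
  moreover have "(p + 1) mod int n = (int m + 1) mod int n" by (simp add: m mod_simps)
  then have "nat ((p + 1) mod int n) = Suc m mod n"
    by (simp add: nat_mod_as_int add.commute)
  then have "u (p + 1) = (\<Sum>j<Suc m mod n. c (int j))" by (simp only: u_def)
  moreover have "u p = (\<Sum>j<m. c (int j))" by (simp only: u_def m_def)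
  ultimately show "u p + u (p + 1) = c p"
    using m(2) assms(2) by (cases "Suc m = n") (auto simp: weight_def bit_add_eq_0_iff)
qed

text \<open>The map 1 + shift sends the periodic sequences onto those of even weight, with the two
  constant sequences as kernel; this accounts for the factor 2.\<close>

lemma cyclic_code_extension:
  fixes C n
  defines "C' \<equiv> {x. periodic n x \<and> (\<lambda>i. x i + x (i + 1)) \<in> C}"
  assumes "n > 0" and lin: "linear_code C" and per: "\<And>x. x \<in> C \<Longrightarrow> periodic n x"
  shows "linear_code C'" "card C' = 2 * card {c \<in> C. weight n c = 0}"
proof -
  show lin': "linear_code C'"
    unfolding linear_code_def
  proof (intro conjI ballI)
    show "0 \<in> C'" using lin by (auto simp: C'_def linear_code_def periodic_def zero_fun_def)
    fix x y assume xy: "x \<in> C'" "y \<in> C'"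
    have "(\<lambda>i. (x + y) i + (x + y) (i + 1)) = (\<lambda>i. x i + x (i + 1)) + (\<lambda>i. y i + y (i + 1))"
      by (rule ext) (simp add: ac_simps)
    also have "\<dots> \<in> C" using xy lin unfolding C'_def linear_code_def by blast
    finally show "x + y \<in> C'" using xy by (simp add: C'_def periodic_def)
  qed
  have fin: "finite C'"
    by (rule finite_subset[OF _ finite_periodic[OF \<open>n > 0\<close>]]) (auto simp: C'_def)
  define \<phi> where "\<phi> = (\<lambda>(x :: int \<Rightarrow> bit) i. x i + x (i + 1))"
  have "card C' = card (\<phi> ` C') * card {x \<in> C'. \<phi> x = 0}"
    by (rule card_additive_hom[OF fin lin']) (auto simp: \<phi>_def fun_eq_iff ac_simps)
  moreover have "\<phi> ` C' = {c \<in> C. weight n c = 0}"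
  proof (intro subset_antisym subsetI)
    fix c assume "c \<in> \<phi> ` C'"
    then obtain x where x: "periodic n x" "c = \<phi> x" "c \<in> C" by (auto simp: C'_def \<phi>_def)
    then have "weight n c = 0"
      using weight_shift[OF x(1) \<open>n > 0\<close>] by (simp add: \<phi>_def weight_add)
    with x show "c \<in> {c \<in> C. weight n c = 0}" by simp
  next
    fix c assume c: "c \<in> {c \<in> C. weight n c = 0}"
    then obtain u where "periodic n u" "\<And>p. u p + u (p + 1) = c p"
      using weight_eq_0_obtain[of n c] per \<open>n > 0\<close> by auto
    then have "u \<in> C'" "\<phi> u = c" using c by (simp_all add: C'_def \<phi>_def)
    then show "c \<in> \<phi> ` C'" by blast
  qed
  moreover have "{x \<in> C'. \<phi> x = 0} = {\<lambda>_. 0, \<lambda>_. 1}"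
  proof (intro subset_antisym subsetI)
    fix x assume "x \<in> {x \<in> C'. \<phi> x = 0}"
    then have *: "x (i + 1) = x i" for i
      by (auto simp: \<phi>_def fun_eq_iff bit_add_eq_0_iff)
    have "x i = x 0" for i
    proof (induction i rule: int_induct[where k = 0])
      case (step2 i)
      then show ?case using *[of "i - 1"] by simp
    qed (simp_all add: *)
    then have "x = (\<lambda>_. x 0)" by (simp add: fun_eq_iff)
    then show "x \<in> {\<lambda>_. 0, \<lambda>_. 1}" by (cases "x 0") auto
  next
    fix x :: "int \<Rightarrow> bit" assume "x \<in> {\<lambda>_. 0, \<lambda>_. 1}"
    then obtain a where x: "x = (\<lambda>_. a)" by blast
    have "(0 :: int \<Rightarrow> bit) \<in> C" using lin by (simp add: linear_code_def)
    then show "x \<in> {x \<in> C'. \<phi> x = 0}" by (simp add: x C'_def \<phi>_def periodic_def zero_fun_def)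
  qed
  moreover have "(\<lambda>_. 0) \<noteq> (\<lambda>_ :: int. 1 :: bit)" by (metis zero_neq_one)
  ultimately show "card C' = 2 * card {c \<in> C. weight n c = 0}" by simp
qed

lemma card_even_weight:
  assumes "finite C" "linear_code C" "z \<in> C" "weight n z = 1"
  shows "card C = 2 * card {c \<in> C. weight n c = 0}"
proof -
  \<comment> \<open>The weight becomes a constant sequence so that \<open>card_additive_hom\<close>
    applies.\<close>
  define \<phi> where "\<phi> c = (\<lambda>_ :: int. weight n c)" for c
  have "card C = card (\<phi> ` C) * card {x \<in> C. \<phi> x = 0}"
    by (rule card_additive_hom[OF assms(1,2)]) (auto simp: \<phi>_def fun_eq_iff plus_fun_def weight_add)
  moreover have "\<phi> ` C = {\<lambda>_. 0, \<lambda>_. 1}"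
  proof (intro subset_antisym subsetI)
    fix x assume "x \<in> \<phi> ` C"
    then obtain c where "x = (\<lambda>_. weight n c)" by (auto simp: \<phi>_def)
    then show "x \<in> {\<lambda>_. 0, \<lambda>_. 1}" by (cases "weight n c") auto
  next
    fix x :: "int \<Rightarrow> bit" assume "x \<in> {\<lambda>_. 0, \<lambda>_. 1}"
    moreover have "\<phi> 0 = (\<lambda>_. 0)" "\<phi> z = (\<lambda>_. 1)" "0 \<in> C"
      using assms(2,4) by (simp_all add: \<phi>_def weight_def linear_code_def)
    ultimately show "x \<in> \<phi> ` C" using assms(3) by (metis imageI insertE singletonD)
  qed
  moreover have "(\<lambda>_. 0) \<noteq> (\<lambda>_ :: int. 1 :: bit)" by (metis zero_neq_one)
  moreover have "{x \<in> C. \<phi> x = 0} = {c \<in> C. weight n c = 0}" by (simp add: \<phi>_def fun_eq_iff)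
  ultimately show ?thesis by simp
qed

section \<open>The flips in a regular group\<close>

context praeger_xu
begin

lemma pverts_PX: "pverts (PX n k) = V"
  by (simp add: PX_def V_def)

lemma parcs_PX: "(u, v) \<in> parcs (PX n k) \<longleftrightarrow> adj u v"
  by (auto simp: PX_def adj_def step_def)

context
  fixes A
  assumes A: "regular_automorphisms A (PX n k)"
begin

lemma A_aut: "g \<in> A \<Longrightarrow> aut g"
  using A by (simp add: regular_automorphisms_def aut_def pverts_PX parcs_PX)

lemma A_regular:
  shows A_id: "id \<in> A"
    and "\<forall>g\<in>A. \<forall>h\<in>A. g \<circ> h \<in> A"
    and "\<forall>g\<in>A. \<exists>h\<in>A. h \<circ> g = id"
    and "\<forall>u\<in>V. \<forall>v\<in>V. \<exists>g\<in>A. g u = v"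
    and "\<forall>u\<in>V. \<forall>g\<in>A. \<forall>h\<in>A. g u = h u \<longrightarrow> g = h"
  using A unfolding regular_automorphisms_def pverts_PX by - (elim conjE, assumption)+

lemma A_comp: "g \<in> A \<Longrightarrow> h \<in> A \<Longrightarrow> g \<circ> h \<in> A"
  and A_inv: "g \<in> A \<Longrightarrow> \<exists>h\<in>A. h \<circ> g = id"
  and A_trans: "u \<in> V \<Longrightarrow> v \<in> V \<Longrightarrow> \<exists>g\<in>A. g u = v"
  and A_semiregular: "u \<in> V \<Longrightarrow> g \<in> A \<Longrightarrow> h \<in> A \<Longrightarrow> g u = h u \<Longrightarrow> g = h"
  using A_regular by simp_all

lemma A_acts: "g \<in> A \<Longrightarrow> (\<exists>s c. periodic n c \<and> acts g s c) \<or> (\<exists>s c. periodic n c \<and> acts (rv \<circ> g) s c)"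
  using aut_acts A_aut by blast

lemma A_in_V: "g \<in> A \<Longrightarrow> v \<in> V \<Longrightarrow> g v \<in> V"
  using aut_in_V A_aut by blast

definition flips :: "(int \<Rightarrow> bit) set" where
  "flips = {c. periodic n c \<and> (\<exists>g\<in>A. acts g 0 c)}"

lemma flipsI: "g \<in> A \<Longrightarrow> acts g 0 c \<Longrightarrow> periodic n c \<Longrightarrow> c \<in> flips"
  by (auto simp: flips_def)

lemma linear_code_flips: "linear_code flips"
  unfolding linear_code_def
proof (intro conjI ballI)
  show "0 \<in> flips" using A_id acts_id by (auto intro!: flipsI simp: periodic_def)
  fix c d assume "c \<in> flips" "d \<in> flips"
  then obtain g h where "g \<in> A" "h \<in> A" "acts g 0 c" "acts h 0 d" "periodic n c" "periodic n d"
    by (auto simp: flips_def)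
  then show "c + d \<in> flips"
    using acts_comp[of g 0 c h 0 d] A_comp
    by (intro flipsI[of "g \<circ> h"]) (simp_all add: plus_fun_def add.commute periodic_add)
qed

text \<open>Conjugating the flip \<open>d\<close> by \<open>g\<close> shifts it by \<open>s\<close>,
  while the flip \<open>c\<close> of \<open>g\<close> cancels.\<close>

lemma flips_shift:
  assumes "g \<in> A" "acts g s c" "d \<in> flips"
  shows "(\<lambda>i. d (i + s)) \<in> flips"
proof -
  obtain h where h: "h \<in> A" "acts h 0 d" "periodic n d" using assms(3) by (auto simp: flips_def)
  obtain g' where g': "g' \<in> A" "g' \<circ> g = id" using A_inv assms(1) by blast
  then have "acts g' (- s) (\<lambda>p. c (p - s))"
    by (intro acts_inv[OF assms(2)]) (metis comp_apply id_apply)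
  from acts_comp[OF this acts_comp[OF h(2) assms(2)]]
  have "acts (g' \<circ> (h \<circ> g)) 0 (\<lambda>p. d (p + s))" by (simp add: add.commute add.left_commute)
  then show ?thesis
    by (rule flipsI[OF A_comp[OF g'(1) A_comp[OF h(1) assms(1)]] _ periodic_shift[OF h(3)]])
qed

lemma finite_flips: "finite flips"
  by (rule finite_subset[OF _ finite_periodic[of n]]) (use n3 in \<open>auto simp: flips_def\<close>)

definition pure :: "(nat \<times> bit list \<Rightarrow> nat \<times> bit list) set" where
  "pure = {g \<in> A. \<exists>c. periodic n c \<and> acts g 0 c}"

text \<open>The orientation-reversing elements of \<open>A\<close> that map fibre 0 to
  itself.\<close>

definition reflections :: "(nat \<times> bit list \<Rightarrow> nat \<times> bit list) set" where
  "reflections = {g \<in> A. \<exists>c. periodic n c \<and> acts (rv \<circ> g) 0 c}"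

lemma card_pure: "card pure = card flips"
proof -
  define \<phi> where "\<phi> g = (SOME c. periodic n c \<and> acts g 0 c)" for g
  have \<phi>: "periodic n (\<phi> g) \<and> acts g 0 (\<phi> g)" if "g \<in> pure" for g
    using that someI_ex[of "\<lambda>c. periodic n c \<and> acts g 0 c"] by (simp add: \<phi>_def pure_def)
  have "bij_betw \<phi> pure flips"
    unfolding bij_betw_def
  proof
    show "inj_on \<phi> pure"
    proof (rule inj_onI)
      fix g h assume gh: "g \<in> pure" "h \<in> pure" "\<phi> g = \<phi> h"
      then have "g (vt 0 0) = h (vt 0 0)" using \<phi> acts_apply by metis
      then show "g = h" using A_semiregular[of "vt 0 0" g h] gh by (simp add: pure_def)
    qed
    show "\<phi> ` pure = flips"
    proof (intro subset_antisym subsetI)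
      fix c assume "c \<in> flips"
      then obtain g where g: "g \<in> pure" "acts g 0 c" by (auto simp: flips_def pure_def)
      then have "\<phi> g = c" using \<phi> acts_unique by blast
      then show "c \<in> \<phi> ` pure" using g by blast
    next
      fix c assume "c \<in> \<phi> ` pure"
      then obtain g where "g \<in> pure" "c = \<phi> g" by blast
      then show "c \<in> flips" using \<phi> by (auto simp: pure_def intro: flipsI)
    qed
  qed
  then show ?thesis by (rule bij_betw_same_card)
qed

lemma pure_Un_reflections: "pure \<union> reflections = {g \<in> A. fst (g (vt 0 0)) = 0}"
proof (intro subset_antisym subsetI)
  fix g assume "g \<in> pure \<union> reflections"
  then consider c where "g \<in> A" "acts g 0 c" | c where "g \<in> A" "acts (rv \<circ> g) 0 c"
    by (auto simp: pure_def reflections_def)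
  then show "g \<in> {g \<in> A. fst (g (vt 0 0)) = 0}"
  proof cases
    case 1
    then show ?thesis by (simp add: acts_apply fst_vt)
  next
    case 2
    then show ?thesis using acts_rv_index[OF 2(2) A_in_V[OF 2(1) vt_in_V], of 0 0 0] by (simp add: fst_vt)
  qed
next
  fix g assume "g \<in> {g \<in> A. fst (g (vt 0 0)) = 0}"
  then have g: "g \<in> A" "fst (g (vt 0 0)) = fst (vt 0 0)" by (auto simp: fst_vt)
  from A_acts[OF g(1)] show "g \<in> pure \<union> reflections"
  proof (elim disjE exE conjE)
    fix s c assume c: "periodic n c" "acts g s c"
    then have "[s = 0] (mod int n)" using g by (simp add: acts_apply fst_eq_cong)
    then show ?thesis using acts_cong[OF c(2)] c g by (auto simp: pure_def)
  next
    fix s c assume c: "periodic n c" "acts (rv \<circ> g) s c"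
    have "fst (vt 0 0) = fst (vt (- (0 + s)) 0)"
      using acts_rv_index[OF c(2) A_in_V[OF g(1) vt_in_V]] g(2) by metis
    then have "[0 = - s] (mod int n)" by (simp add: fst_eq_cong)
    then have "[s = 0] (mod int n)" by (metis cong_minus_minus_iff cong_sym minus_zero)
    then show ?thesis using acts_cong[OF c(2)] c g by (auto simp: reflections_def)
  qed
qed

text \<open>This set is the setwise stabiliser of fibre 0; by regularity it corresponds to the
  \<open>2 ^ k\<close> vertices of that fibre.\<close>

lemma card_pure_Un_reflections:
  "card (pure \<union> reflections) = 2 ^ k" "finite (pure \<union> reflections)"
proof -
  have "bij_betw (\<lambda>g. g (vt 0 0)) (pure \<union> reflections) ({0} \<times> {xs. length xs = k})"
    unfolding pure_Un_reflections bij_betw_def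
  proof
    show "inj_on (\<lambda>g. g (vt 0 0)) {g \<in> A. fst (g (vt 0 0)) = 0}"
      by (rule inj_onI) (use A_semiregular[OF vt_in_V] in blast)
    show "(\<lambda>g. g (vt 0 0)) ` {g \<in> A. fst (g (vt 0 0)) = 0} = {0} \<times> {xs. length xs = k}"
    proof (intro subset_antisym subsetI)
      fix v assume "v \<in> (\<lambda>g. g (vt 0 0)) ` {g \<in> A. fst (g (vt 0 0)) = 0}"
      then show "v \<in> {0} \<times> {xs. length xs = k}"
        using A_in_V[OF _ vt_in_V] by (force simp: V_def mem_Times_iff)
    next
      fix v :: "nat \<times> bit list" assume v: "v \<in> {0} \<times> {xs. length xs = k}"
      then have "v \<in> V" using n3 by (auto simp: V_def)
      then obtain g where "g \<in> A" "g (vt 0 0) = v" using A_trans vt_in_V by blast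
      with v show "v \<in> (\<lambda>g. g (vt 0 0)) ` {g \<in> A. fst (g (vt 0 0)) = 0}" by auto
    qed
  qed
  moreover have "card ({0 :: nat} \<times> {xs :: bit list. length xs = k}) = 2 ^ k"
    using card_lists_length_eq[OF finite_UNIV_bit, of k] by (simp add: card_cartesian_product card_UNIV_bit)
  ultimately show *: "card (pure \<union> reflections) = 2 ^ k" by (metis bij_betw_same_card)
  show "finite (pure \<union> reflections)" by (rule card_ge_0_finite) (simp add: *)
qed

lemma pure_Int_reflections: "pure \<inter> reflections = {}"
  using acts_not_rv by (auto simp: pure_def reflections_def)

lemma reflections_comp:
  assumes "r \<in> reflections" "s \<in> reflections"
  shows "r \<circ> s \<in> pure"
proof -
  obtain c d where c: "periodic n c" "acts (rv \<circ> r) 0 c" and d: "periodic n d" "acts (rv \<circ> s) 0 d"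
    and A: "r \<in> A" "s \<in> A" using assms by (auto simp: reflections_def)
  have "acts (r \<circ> s) 0 (\<lambda>p. d p + c (int k - 1 - p))"
    using acts_rv_rv[OF c(2) d(2)] A_in_V A by simp
  then show ?thesis
    using A_comp[OF A] periodic_add[OF d(1) periodic_reflect[OF c(1)]] unfolding pure_def by blast
qed

lemma reflections_comp_pure:
  assumes "r \<in> reflections" "g \<in> pure"
  shows "r \<circ> g \<in> reflections"
proof -
  obtain c d where c: "periodic n c" "acts (rv \<circ> r) 0 c" and d: "periodic n d" "acts g 0 d"
    and A: "r \<in> A" "g \<in> A" using assms by (auto simp: reflections_def pure_def)
  have "acts (rv \<circ> (r \<circ> g)) 0 (\<lambda>p. d p + c p)"
    using acts_rv_left[OF c(2) d(2)] by simp
  then show ?thesis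
    using A_comp[OF A] periodic_add[OF d(1) c(1)] unfolding reflections_def by blast
qed

text \<open>Composition with \<open>r\<close> exchanges \<open>pure\<close> and
  \<open>reflections\<close>, so each is half of the stabiliser of fibre 0.\<close>

lemma card_flips_reflection:
  assumes "r \<in> reflections"
  shows "2 * card flips = 2 ^ k"
proof -
  have fin: "finite pure" "finite reflections" using card_pure_Un_reflections(2) by auto
  have "r \<in> A" using assms by (simp add: reflections_def)
  then obtain r' where "r' \<circ> r = id" using A_inv by blast
  then have inj: "inj_on (\<lambda>g. r \<circ> g) B" for B :: "(nat \<times> bit list \<Rightarrow> nat \<times> bit list) set"
    by (intro inj_onI) (metis comp_assoc id_comp)
  have "card pure \<le> card reflections"
    by (rule card_inj_on_le[OF inj _ fin(2)]) (use assms reflections_comp_pure in auto)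
  moreover have "card reflections \<le> card pure"
    by (rule card_inj_on_le[OF inj _ fin(1)]) (use assms reflections_comp in auto)
  moreover have "card (pure \<union> reflections) = card pure + card reflections"
    by (rule card_Un_disjoint[OF fin pure_Int_reflections])
  ultimately show ?thesis using card_pure_Un_reflections card_pure by simp
qed

text \<open>Some element moves fibre 0 to fibre \<open>s\<close>; if it reverses the orientation,
  following it with \<open>rv\<close> turns \<open>s\<close> into \<open>- s\<close>.\<close>

lemma A_rotation_cases:
  obtains g c where "g \<in> A" "periodic n c" "acts g s c"
  | g c where "g \<in> A" "periodic n c" "acts (rv \<circ> g) (- s) c"
proof -
  obtain g where g: "g \<in> A" "g (vt 0 0) = vt s 0" using A_trans vt_in_V by blast
  from A_acts[OF g(1)] show ?thesis
  proof (elim disjE exE conjE)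
    fix t c assume c: "periodic n c" "acts g t c"
    then have "[t = s] (mod int n)" using g acts_apply[OF c(2), of 0 0] by (metis add_0 fst_eq_cong)
    then show ?thesis using acts_cong[OF c(2)] c g that by blast
  next
    fix t c assume c: "periodic n c" "acts (rv \<circ> g) t c"
    have "fst (vt s 0) = fst (vt (- (0 + t)) 0)"
      using acts_rv_index[OF c(2) A_in_V[OF g(1) vt_in_V]] g(2) by metis
    then have "[s = - t] (mod int n)" by (simp add: fst_eq_cong)
    then have "[t = - s] (mod int n)" by (metis cong_minus_minus_iff cong_sym minus_minus)
    then show ?thesis using acts_cong[OF c(2)] c g that by blast
  qed
qed

text \<open>If the chosen element for rotation by 2 reverses the orientation, consider one for
  rotation by 1. Either that one preserves orientation, or the product of both does and rotates by 2
  - 1; in both cases a rotation by 1 is available and is used twice.\<close>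

lemma flips_shift2: "c \<in> flips \<Longrightarrow> (\<lambda>i. c (i + 2)) \<in> flips"
proof -
  assume c: "c \<in> flips"
  have twice: "(\<lambda>i. c (i + 2)) \<in> flips" if "g \<in> A" "acts g 1 d" for g d
    using flips_shift[OF that flips_shift[OF that c]] by (simp add: add.commute)
  show ?thesis
  proof (cases rule: A_rotation_cases[of 2])
    case (1 g d)
    then show ?thesis using flips_shift c by blast
  next
    case (2 g d)
    note g = this
    show ?thesis
    proof (cases rule: A_rotation_cases[of 1])
      case (2 h e)
      have "acts (g \<circ> h) 1 (\<lambda>p. e p + d (int k - 1 - (p + - 1)))"
        using acts_rv_rv[OF g(3) 2(3)] A_in_V g 2 by simp
      then show ?thesis by (rule twice[OF A_comp[OF g(1) 2(1)]])
    qed (use twice in blast)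
  qed
qed

text \<open>If an element moving fibre 0 to fibre 1 reverses the orientation, precomposing it with
  \<open>r\<close> restores it.\<close>

lemma reflection_rotation:
  assumes "r \<in> reflections"
  obtains g c where "g \<in> A" "periodic n c" "acts g 1 c"
proof (cases rule: A_rotation_cases[of 1])
  case (2 g d)
  obtain c where c: "r \<in> A" "periodic n c" "acts (rv \<circ> r) 0 c"
    using assms by (auto simp: reflections_def)
  have "acts (g \<circ> r) 1 (\<lambda>p. c p + d (int k - 1 - p))"
    using acts_rv_rv[OF 2(3) c(3)] A_in_V 2 c by simp
  then show ?thesis
    by (rule that[OF A_comp[OF 2(1) c(1)] periodic_add[OF c(2) periodic_reflect[OF 2(2)]]])
qed (use that in blast)

text \<open>If some flip has odd weight, then conjugating by a flip \<open>u\<close> turns a rotation in the group into a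
  pure shift and a reflection in the group into a pure reversal, which fixes the all-zero vertex.\<close>

lemma reflection_even_weight:
  assumes r: "r \<in> reflections" and z: "z \<in> flips"
  shows "weight n z = 0"
proof (rule ccontr)
  assume "weight n z \<noteq> 0"
  then have wz: "weight n z = 1" by simp
  have "n > 0" using n3 by simp
  obtain \<rho> where \<rho>: "r \<in> A" "periodic n \<rho>" "acts (rv \<circ> r) 0 \<rho>"
    using r by (auto simp: reflections_def)
  \<comment> \<open>Composing with the odd flip \<open>z\<close> corrects the parity of
    \<open>c\<close> when necessary.\<close>
  obtain g c where g: "g \<in> A" "periodic n c" "acts g 1 c" "weight n c = 0"
  proof -
    obtain g c where g: "g \<in> A" "periodic n c" "acts g 1 c" using reflection_rotation[OF r] by blast
    obtain h where h: "h \<in> A" "periodic n z" "acts h 0 z" using z by (auto simp: flips_def)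
    show ?thesis
    proof (cases "weight n c = 0")
      case False
      have "acts (g \<circ> h) 1 (\<lambda>p. z p + c p)" using acts_comp[OF g(3) h(3)] by simp
      moreover have "weight n (\<lambda>p. z p + c p) = 0" using False wz by (simp add: weight_add)
      ultimately show ?thesis
        by (rule that[OF A_comp[OF g(1) h(1)] periodic_add[OF h(2) g(2)]])
    qed (use that g in blast)
  qed
  obtain u where u: "periodic n u" "\<And>p. u p + u (p + 1) = c p"
    using weight_eq_0_obtain[OF g(2,4) \<open>n > 0\<close>] by blast
  \<comment> \<open>After conjugation by \<open>u\<close>, the flip \<open>y\<close> is what
    separates the reflection \<open>r\<close> from a pure reversal.\<close>
  define y where "y p = \<rho> p + u p + u (int k - 1 - p)" for p
  \<comment> \<open>The squares of \<open>r \<circ> g\<close> and of \<open>r\<close> are flips in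
    the group; their sum is \<open>y\<close> plus its shift, so \<open>y\<close> lies in
    \<open>C'\<close>.\<close>
  have "acts (rv \<circ> (r \<circ> g)) 1 (\<lambda>p. c p + \<rho> (p + 1))" using acts_rv_left[OF \<rho>(3) g(3)] by simp
  from acts_rv_rv[OF this this]
  have "acts (r \<circ> g \<circ> (r \<circ> g)) 0 (\<lambda>p. c p + \<rho> (p + 1) + (c (int k - 2 - p) + \<rho> (int k - 1 - p)))"
    using A_in_V \<rho>(1) g(1) by (simp add: algebra_simps)
  then have 1: "(\<lambda>p. c p + \<rho> (p + 1) + (c (int k - 2 - p) + \<rho> (int k - 1 - p))) \<in> flips"
    using \<rho> g by (intro flipsI) (auto intro!: A_comp periodic_add periodic_reflect periodic_shift)
  have "acts (r \<circ> r) 0 (\<lambda>p. \<rho> p + \<rho> (int k - 1 - p))" using acts_rv_rv[OF \<rho>(3) \<rho>(3)] A_in_V \<rho>(1) by simp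
  then have 2: "(\<lambda>p. \<rho> p + \<rho> (int k - 1 - p)) \<in> flips"
    using \<rho> by (intro flipsI) (auto intro!: A_comp periodic_add periodic_reflect)
  define C' where "C' = {x. periodic n x \<and> (\<lambda>i. x i + x (i + 1)) \<in> flips}"
  have per: "\<And>x. x \<in> flips \<Longrightarrow> periodic n x" by (simp add: flips_def)
  have "y \<in> C'"
  proof -
    have "(\<lambda>i. y i + y (i + 1)) =
      (\<lambda>p. c p + \<rho> (p + 1) + (c (int k - 2 - p) + \<rho> (int k - 1 - p))) + (\<lambda>p. \<rho> p + \<rho> (int k - 1 - p))"
    proof
      fix p
      have "c (int k - 2 - p) = u (int k - 2 - p) + u (int k - 1 - p)"
        using u(2)[of "int k - 2 - p"] by (simp add: algebra_simps)
      moreover have "y (p + 1) = \<rho> (p + 1) + u (p + 1) + u (int k - 2 - p)"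
        by (simp add: y_def algebra_simps)
      ultimately show "y p + y (p + 1) =
        ((\<lambda>p. c p + \<rho> (p + 1) + (c (int k - 2 - p) + \<rho> (int k - 1 - p))) + (\<lambda>p. \<rho> p + \<rho> (int k - 1 - p))) p"
        by (simp add: y_def ac_simps flip: u(2)[of p])
    qed
    also have "\<dots> \<in> flips" using 1 2 linear_code_flips unfolding linear_code_def by blast
    finally show ?thesis
      using \<rho> u unfolding C'_def y_def by (auto intro!: periodic_add periodic_reflect)
  qed
  \<comment> \<open>Shift invariance gives the inclusion. The sizes agree because the odd word
    \<open>z\<close> makes the even words half of \<open>flips\<close>, and \<open>C'\<close> has
    twice as many elements as these.\<close>
  moreover have "flips = C'"
  proof (rule card_subset_eq)
    show "finite C'" by (rule finite_subset[OF _ finite_periodic[OF \<open>n > 0\<close>]]) (auto simp: C'_def)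
    show "flips \<subseteq> C'"
    proof
      fix x assume x: "x \<in> flips"
      have "x + (\<lambda>i. x (i + 1)) \<in> flips"
        using linear_code_flips x flips_shift[OF g(1,3) x] unfolding linear_code_def by blast
      then show "x \<in> C'" using per[OF x] by (simp add: C'_def plus_fun_def)
    qed
    show "card flips = card C'"
      using cyclic_code_extension(2)[OF \<open>n > 0\<close> linear_code_flips per]
        card_even_weight[OF finite_flips linear_code_flips z wz] by (simp add: C'_def)
  qed
  ultimately obtain f where f: "f \<in> A" "acts f 0 y" by (auto simp: flips_def)
  \<comment> \<open>Cancelling \<open>y\<close> makes \<open>r \<circ> f\<close> fix the vertex
    \<open>vt 0 u\<close>, so regularity forces it to be the identity although it reverses the
    orientation.\<close>
  have rf: "acts (rv \<circ> (r \<circ> f)) 0 (\<lambda>p. y p + \<rho> p)" using acts_rv_left[OF \<rho>(3) f(2)] by simp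
  have V: "(r \<circ> f) (vt 0 u) \<in> V" using A_in_V f \<rho> by simp
  have "rv ((r \<circ> f) (vt 0 u)) = vt 0 (\<lambda>p. u (int k - 1 - p))"
    using acts_apply[OF rf, of 0 u] by (simp add: y_def ac_simps)
  then have "(r \<circ> f) (vt 0 u) = rv (vt 0 (\<lambda>p. u (int k - 1 - p)))" using rv_rv[OF V] by simp
  then have "(r \<circ> f) (vt 0 u) = id (vt 0 u)" by (simp add: rv_vt)
  then have "r \<circ> f = id" using A_semiregular[OF vt_in_V] A_comp A_id f \<rho> by blast
  then show False using acts_not_rv[OF acts_id] rf by metis
qed

lemma regular_imp_divisor: "\<exists>f. f dvd cyc n \<and> degree f = k"
proof -
  have "n > 0" using n3 by simp
  have per: "\<And>x. x \<in> flips \<Longrightarrow> periodic n x" by (simp add: flips_def)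
  have "\<exists>f. f dvd cyc n \<and> (2 :: nat) ^ k = 2 ^ degree f"
  proof (cases "reflections = {}")
    case True
    then have "card flips = 2 ^ k" using card_pure card_pure_Un_reflections by simp
    then show ?thesis
      using card_cyclic_code2[OF \<open>n > 0\<close> linear_code_flips per flips_shift2] by simp
  next
    case False
    then obtain r where r: "r \<in> reflections" by blast
    obtain g c where g: "g \<in> A" "periodic n c" "acts g 1 c" using reflection_rotation[OF r] by blast
    \<comment> \<open>As all flips have even weight, this code has twice the size of
      \<open>flips\<close>, which makes up for the half taken by the reflections.\<close>
    define C' where "C' = {x. periodic n x \<and> (\<lambda>i. x i + x (i + 1)) \<in> flips}"
    have "{c \<in> flips. weight n c = 0} = flips" using reflection_even_weight[OF r] by blast
    then have card: "card C' = 2 ^ k"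
      using cyclic_code_extension(2)[OF \<open>n > 0\<close> linear_code_flips per] card_flips_reflection[OF r]
      by (simp add: C'_def)
    have lin: "linear_code C'"
      unfolding C'_def by (rule cyclic_code_extension(1)[OF \<open>n > 0\<close> linear_code_flips per])
    have shift: "(\<lambda>i. x (i + 1)) \<in> C'" if "x \<in> C'" for x
      using that flips_shift[OF g(1,3), of "\<lambda>i. x i + x (i + 1)"] periodic_shift[of n x 1]
      by (simp add: C'_def)
    have "periodic n x" if "x \<in> C'" for x using that by (simp add: C'_def)
    from card_cyclic_code[OF \<open>n > 0\<close> lin this shift] show ?thesis by (simp only: card)
  qed
  then show ?thesis by auto
qed

end

lemma cayley_imp_divisor: "cayley_graph (PX n k) \<Longrightarrow> \<exists>f. f dvd cyc n \<and> degree f = k"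
  using cayley_graph_regular regular_imp_divisor by blast

end

section \<open>The exceptional cases and the equivalence\<close>

lemma cyc_has_divisor_of_degree:
  assumes "k \<le> 2 ^ a"
  shows "\<exists>f. f dvd cyc (2 ^ a * b) \<and> degree f = k"
proof (intro exI[of _ "cyc 1 ^ k"] conjI)
  have "cyc 1 ^ k dvd cyc 1 ^ 2 ^ a" using assms by (rule le_imp_power_dvd)
  also have "\<dots> = cyc (2 ^ a)" by (simp add: cyc_power2)
  also have "\<dots> dvd cyc (2 ^ a * b)" by (rule cyc_dvd_cyc_mult)
  finally show "cyc 1 ^ k dvd cyc (2 ^ a * b)" .
  show "degree (cyc 1 ^ k) = k" by (simp add: degree_power_eq)
qed

lemma cayley_PX_iff_divisor:
  assumes "n \<ge> 3" "k \<ge> 1" "k \<le> n - 1"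
  shows "cayley_graph (PX n k) \<longleftrightarrow> (\<exists>f. f dvd cyc n \<and> degree f = k)"
proof
  assume cayley: "cayley_graph (PX n k)"
  \<comment> \<open>For \<open>k = 1\<close> the divisor is t - 1; for \<open>n = 4\<close> we have
    \<open>k \<le> 3\<close>, and the \<open>k\<close>-th power of t - 1 divides its fourth power
    t^4 - 1.\<close>
  consider "k = 1" | "n = 4" | "n \<noteq> 4" "2 \<le> k" using assms by linarith
  then show "\<exists>f. f dvd cyc n \<and> degree f = k"
  proof cases
    case 1
    then show ?thesis using cyc_has_divisor_of_degree[of k 0 n] by simp
  next
    case 2
    then show ?thesis using cyc_has_divisor_of_degree[of k 2 1] assms by simp
  next
    case 3
    then interpret praeger_xu n k using assms by unfold_locales
    show ?thesis using cayley by (rule cayley_imp_divisor)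
  qed
qed (use assms cayley_PX_if_divisor in blast)

theorem corollary2:
  fixes a b n k :: nat
  assumes "odd b" and "n = 2 ^ a * b" and "n \<ge> 3" and "k \<ge> 1" and "k \<le> n - 1"
  shows "cayley_graph (PX n k) \<longleftrightarrow>
    (\<exists>\<alpha> :: nat \<Rightarrow> int.
       (\<forall>d. d dvd b \<longrightarrow> 0 \<le> \<alpha> d \<and>
          real_of_int (\<alpha> d) \<le> 2 ^ a * real (totient d) / real (omega d)) \<and>
       int k = (\<Sum>d | d dvd b. \<alpha> d * int (omega d)))"
proof -
  \<comment> \<open>The quotient of \<open>totient d\<close> by \<open>omega d\<close> is the number
    of primes of order \<open>d\<close>, so the real bound is a natural number and the coefficients
    can be taken in \<open>nat\<close>.\<close>
  have bound: "2 ^ a * real (totient d) / real (omega d) = real (2 ^ a * card (cyc_primes d))" if "d dvd b" for d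
  proof -
    have "odd d" using that \<open>odd b\<close> by (auto elim: dvdE)
    then have "card (cyc_primes d) * omega d = totient d" by (rule card_cyc_primes)
    moreover have "totient d > 0" using \<open>odd d\<close> by (auto intro: Nat.gr0I)
    ultimately have "omega d \<noteq> 0" "real (totient d) = real (card (cyc_primes d)) * real (omega d)"
      by (metis mult_0_right not_gr0, metis of_nat_mult)
    then show ?thesis by simp
  qed
  have "cayley_graph (PX n k) \<longleftrightarrow> (\<exists>f. f dvd cyc (2 ^ a * b) \<and> degree f = k)"
    using cayley_PX_iff_divisor assms by blast
  also have "\<dots> \<longleftrightarrow> (\<exists>e. (\<forall>d. d dvd b \<longrightarrow> e d \<le> 2 ^ a * card (cyc_primes d)) \<and>
      k = (\<Sum>d | d dvd b. e d * omega d))"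
    by (rule degree_divisors_cyc) fact
  also have "\<dots> \<longleftrightarrow> (\<exists>\<alpha> :: nat \<Rightarrow> int.
       (\<forall>d. d dvd b \<longrightarrow> 0 \<le> \<alpha> d \<and>
          real_of_int (\<alpha> d) \<le> 2 ^ a * real (totient d) / real (omega d)) \<and>
       int k = (\<Sum>d | d dvd b. \<alpha> d * int (omega d)))" (is "?L \<longleftrightarrow> ?R")
  proof
    assume ?L
    then obtain e where e: "\<And>d. d dvd b \<Longrightarrow> e d \<le> 2 ^ a * card (cyc_primes d)"
      "k = (\<Sum>d | d dvd b. e d * omega d)" by blast
    have "real (e d) \<le> 2 ^ a * real (totient d) / real (omega d)" if "d dvd b" for d
      unfolding bound[OF that] using e(1)[OF that] by (simp only: of_nat_le_iff)
    with e(2) show ?R by (intro exI[of _ "\<lambda>d. int (e d)"]) simp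
  next
    assume ?R
    then obtain \<alpha> where \<alpha>: "\<And>d. d dvd b \<Longrightarrow> 0 \<le> \<alpha> d"
      "\<And>d. d dvd b \<Longrightarrow> real_of_int (\<alpha> d) \<le> 2 ^ a * real (totient d) / real (omega d)"
      "int k = (\<Sum>d | d dvd b. \<alpha> d * int (omega d))" by blast
    have "nat (\<alpha> d) \<le> 2 ^ a * card (cyc_primes d)" if "d dvd b" for d
    proof -
      have "real_of_int (\<alpha> d) \<le> real (2 ^ a * card (cyc_primes d))"
        using \<alpha>(2)[OF that] unfolding bound[OF that] .
      then have "\<alpha> d \<le> int (2 ^ a * card (cyc_primes d))" by linarith
      then show ?thesis by (simp add: nat_le_iff)
    qed
    moreover have "int k = (\<Sum>d | d dvd b. int (nat (\<alpha> d)) * int (omega d))"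
      unfolding \<alpha>(3) by (rule sum.cong) (use \<alpha>(1) in auto)
    then have "int k = int (\<Sum>d | d dvd b. nat (\<alpha> d) * omega d)" by simp
    then have "k = (\<Sum>d | d dvd b. nat (\<alpha> d) * omega d)" by (simp only: of_nat_eq_iff)
    ultimately show ?L by (intro exI[of _ "\<lambda>d. nat (\<alpha> d)"]) simp
  qed
  finally show ?thesis .
qed

end
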